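(* For every infinite extremely disconnected compact space $K$ there exist a compact space $L$ and a continuous surjection $\varphi\colon K\to L$ such that $L$ does not have the Grothendieck property but it has the $\ell_1$-Grothendieck property.
   Context: All compact spaces are Hausdorff; a space is extremely disconnected if the closure of every open set is open. A measure on $L$ is a signed $\sigma$-additive Radon measure on the Borel $\sigma$-algebra of $L$; $\ell_1(L)$ is the space of all countably supported measures on $L$ (of the form $\sum_x\alpha_x\delta_x$ with $\sum_x|\alpha_x|<\infty$). A sequence of measures $\mu_n$ on $L$ is weakly* convergent to $\mu$ if $\int_L f\,d\mu_n\to\int_L f\,d\mu$ for every $f\in C(L)$, and weakly convergent to $\mu$ if $\mu_n(B)\to\mu(B)$ for every Borel $B\subseteq L$. $L$ has the Grothendieck property if every weakly* convergent sequence of measures on $L$ is weakly convergent; $L$ has the $\ell_1$-Grothendieck property if every weakly* convergent sequence of measures from $\ell_1(L)$ is weakly convergent. *)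

theory Defs
  imports "HOL-Analysis.Analysis"
begin

definition extremally_disconnected_space :: "'a topology \<Rightarrow> bool" where
  "extremally_disconnected_space X \<longleftrightarrow> (\<forall>U. openin X U \<longrightarrow> openin X (X closure_of U))"

definition borel_of :: "'a topology \<Rightarrow> 'a measure" where
  "borel_of X = sigma (topspace X) {U. openin X U}"

text \<open>A signed measure is represented by a real-valued function on sets of points.
  Only its values on Borel sets are meaningful; no definition below looks at the other values.\<close>

definition signed_measure :: "'a topology \<Rightarrow> ('a set \<Rightarrow> real) \<Rightarrow> bool" where
  "signed_measure X \<mu> \<longleftrightarrow>
     \<mu> {} = 0 \<and>
     (\<forall>A :: nat \<Rightarrow> 'a set. range A \<subseteq> sets (borel_of X) \<longrightarrow> disjoint_family A \<longrightarrow>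
        (\<lambda>n. \<mu> (A n)) sums \<mu> (\<Union>n. A n))"

text \<open>Jordan decomposition: the positive and negative variation. For a signed measure the
  suprema are over nonempty bounded sets of reals, since a real-valued signed measure is bounded.\<close>

definition pos_var :: "'a topology \<Rightarrow> ('a set \<Rightarrow> real) \<Rightarrow> 'a set \<Rightarrow> real" where
  "pos_var X \<mu> B = (SUP C\<in>{C \<in> sets (borel_of X). C \<subseteq> B}. \<mu> C)"

definition neg_var :: "'a topology \<Rightarrow> ('a set \<Rightarrow> real) \<Rightarrow> 'a set \<Rightarrow> real" where
  "neg_var X \<mu> B = (SUP C\<in>{C \<in> sets (borel_of X). C \<subseteq> B}. - \<mu> C)"

definition total_var :: "'a topology \<Rightarrow> ('a set \<Rightarrow> real) \<Rightarrow> 'a set \<Rightarrow> real" where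
  "total_var X \<mu> B = pos_var X \<mu> B + neg_var X \<mu> B"

text \<open>Radon: the total variation is inner regular with respect to compact sets.\<close>

definition radon_measure :: "'a topology \<Rightarrow> ('a set \<Rightarrow> real) \<Rightarrow> bool" where
  "radon_measure X \<mu> \<longleftrightarrow>
     signed_measure X \<mu> \<and>
     (\<forall>B \<in> sets (borel_of X). \<forall>\<epsilon>>0. \<exists>C \<in> sets (borel_of X).
        compactin X C \<and> C \<subseteq> B \<and> total_var X \<mu> (B - C) < \<epsilon>)"

definition signed_integral :: "'a topology \<Rightarrow> ('a set \<Rightarrow> real) \<Rightarrow> ('a \<Rightarrow> real) \<Rightarrow> real" where
  "signed_integral X \<mu> f =
     integral\<^sup>L (measure_of (topspace X) (sets (borel_of X)) (\<lambda>B. ennreal (pos_var X \<mu> B))) f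
   - integral\<^sup>L (measure_of (topspace X) (sets (borel_of X)) (\<lambda>B. ennreal (neg_var X \<mu> B))) f"

definition ell1_measure :: "'a topology \<Rightarrow> ('a set \<Rightarrow> real) \<Rightarrow> bool" where
  "ell1_measure X \<mu> \<longleftrightarrow>
     (\<exists>S \<alpha>. countable S \<and> S \<subseteq> topspace X \<and> (\<lambda>x. \<bar>\<alpha> x\<bar>) summable_on S \<and>
        (\<forall>B \<in> sets (borel_of X). \<mu> B = (\<Sum>\<^sub>\<infinity>x\<in>S. \<alpha> x * indicator B x)))"

definition weakstar_converges ::
  "'a topology \<Rightarrow> (nat \<Rightarrow> 'a set \<Rightarrow> real) \<Rightarrow> ('a set \<Rightarrow> real) \<Rightarrow> bool" where
  "weakstar_converges X \<mu>s \<mu> \<longleftrightarrow>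
     (\<forall>f. continuous_map X euclideanreal f \<longrightarrow>
        (\<lambda>n. signed_integral X (\<mu>s n) f) \<longlonglongrightarrow> signed_integral X \<mu> f)"

definition weak_converges ::
  "'a topology \<Rightarrow> (nat \<Rightarrow> 'a set \<Rightarrow> real) \<Rightarrow> ('a set \<Rightarrow> real) \<Rightarrow> bool" where
  "weak_converges X \<mu>s \<mu> \<longleftrightarrow>
     (\<forall>B \<in> sets (borel_of X). (\<lambda>n. \<mu>s n B) \<longlonglongrightarrow> \<mu> B)"

definition grothendieck_property :: "'a topology \<Rightarrow> bool" where
  "grothendieck_property X \<longleftrightarrow>
     (\<forall>\<mu>s. (\<forall>n. radon_measure X (\<mu>s n)) \<longrightarrow>
        (\<exists>\<mu>. radon_measure X \<mu> \<and> weakstar_converges X \<mu>s \<mu>) \<longrightarrow>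
        (\<exists>\<mu>. radon_measure X \<mu> \<and> weak_converges X \<mu>s \<mu>))"

text \<open>Only the members of the sequence are required to be in \<open>\<ell>\<^sub>1\<close>; the weak* limit is an
  arbitrary Radon measure.\<close>

definition ell1_grothendieck_property :: "'a topology \<Rightarrow> bool" where
  "ell1_grothendieck_property X \<longleftrightarrow>
     (\<forall>\<mu>s. (\<forall>n. radon_measure X (\<mu>s n) \<and> ell1_measure X (\<mu>s n)) \<longrightarrow>
        (\<exists>\<mu>. radon_measure X \<mu> \<and> weakstar_converges X \<mu>s \<mu>) \<longrightarrow>
        (\<exists>\<mu>. radon_measure X \<mu> \<and> weak_converges X \<mu>s \<mu>))"

end

theory Submission
  imports Defs
begin

text \<open>The quotient \<open>L\<close> is built so that it has a weak* convergent sequence of measures without atoms that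
  does not converge weakly, while measures with countable support cannot imitate such a sequence.

  An infinite extremally disconnected compact space \<open>K\<close> carries a sequence of finitely additive
  probabilities \<open>m k\<close> that live on disjoint clopen sets \<open>U k\<close> and are diffuse: every point has clopen
  neighbourhoods of arbitrarily small content (\<open>diffuse_contents_exist\<close>). Call a clopen set null if its
  contents \<open>m k A\<close> tend to 0. The points outside all null sets form a nonempty closed set, and \<open>L\<close> is
  obtained by collapsing it to a point \<open>p\<close>. A clopen set of \<open>L\<close> that misses \<open>p\<close> is a null set,
  so the Radon measures extending the \<open>m k\<close> converge weak* to the Dirac measure at \<open>p\<close>. They do not
  converge weakly, as each \<open>U j\<close> is null but their union has measure 1 for every \<open>k\<close>
  (\<open>contents_to_point_not_grothendieck\<close>).

  For the \<open>\<ell>\<^sub>1\<close>-Grothendieck property, suppose that a sequence of \<open>\<ell>\<^sub>1\<close> measures converges on clopen sets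
  but is not Cauchy in norm. A gliding hump argument finds differences \<open>a j\<close> of its members and disjoint
  clopen sets with large \<open>a j\<close> mass, and these masses sit, up to a small error, on finite sets \<open>T j\<close>.
  Because the \<open>m k\<close> are diffuse, \<open>T j\<close> has a clopen neighbourhood \<open>B j\<close> of content below \<open>(1/2) ^ j\<close> for
  all \<open>k\<close>, as long as \<open>p\<close> is avoided. In an extremally disconnected space the closure of a union of
  sets \<open>B j\<close> is clopen, and for a suitable infinite set of indices, chosen from an uncountable almost
  disjoint family, the closure adds neither content nor points of the countable supports
  (\<open>null_join_of_subfamily\<close>). So it is null and hence clopen in \<open>L\<close>, and the sequence cannot converge
  on it (\<open>interpolating_uniformly_exhaustive\<close>). Thus the sequence converges in norm, and so on all
  Borel sets (\<open>interpolating_clopens_ell1_grothendieck\<close>).\<close>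

section \<open>Absolutely summable functions as measures\<close>

definition ell1 :: "('a \<Rightarrow> real) \<Rightarrow> bool" where
  "ell1 a \<longleftrightarrow> (\<lambda>x. \<bar>a x\<bar>) summable_on UNIV"

text \<open>An \<open>\<ell>\<^sub>1\<close> measure is handled through its function \<open>a\<close> of point masses: its value on \<open>A\<close> is
  \<open>infsum a A\<close>, and \<open>mass a\<close> is its total variation.\<close>

definition mass :: "('a \<Rightarrow> real) \<Rightarrow> 'a set \<Rightarrow> real" where
  "mass a A = (\<Sum>\<^sub>\<infinity>x\<in>A. \<bar>a x\<bar>)"

lemma ell1_abs_summable_on: "ell1 a \<Longrightarrow> (\<lambda>x. \<bar>a x\<bar>) summable_on A"
  unfolding ell1_def using summable_on_subset_banach by blast

lemma ell1_summable_on: "ell1 a \<Longrightarrow> a summable_on A"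
  using ell1_abs_summable_on[of a A] summable_on_iff_abs_summable_on_real[of a A] by simp

lemma ell1_diff:
  assumes "ell1 a" "ell1 b"
  shows "ell1 (\<lambda>x. a x - b x)"
proof -
  have *: "(\<lambda>x. a x - b x) summable_on UNIV"
    using summable_on_add[OF ell1_summable_on[OF assms(1)], of "\<lambda>x. - b x" UNIV]
      ell1_summable_on[OF assms(2)] by (simp add: summable_on_uminus)
  show ?thesis
    unfolding ell1_def using iffD1[OF summable_on_iff_abs_summable_on_real *] by simp
qed

lemma infsum_ell1_diff:
  assumes "ell1 a" "ell1 b"
  shows "(\<Sum>\<^sub>\<infinity>x\<in>A. a x - b x) = infsum a A - infsum b A"
  using infsum_add[OF ell1_summable_on[OF assms(1)], of "\<lambda>x. - b x" A]
    ell1_summable_on[OF assms(2)] by (simp add: summable_on_uminus infsum_uminus)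

lemma mass_nonneg: "0 \<le> mass a A"
  unfolding mass_def by (rule infsum_nonneg) simp

lemma mass_mono: "ell1 a \<Longrightarrow> A \<subseteq> B \<Longrightarrow> mass a A \<le> mass a B"
  unfolding mass_def
  by (rule infsum_mono2) (auto intro: ell1_abs_summable_on)

lemma mass_Un_disjoint: "ell1 a \<Longrightarrow> A \<inter> B = {} \<Longrightarrow> mass a (A \<union> B) = mass a A + mass a B"
  unfolding mass_def by (rule infsum_Un_disjoint) (auto intro: ell1_abs_summable_on)

lemma mass_Un_le: "ell1 a \<Longrightarrow> mass a (A \<union> B) \<le> mass a A + mass a B"
  using mass_Un_disjoint[of a A "B - A"] mass_mono[of a "B - A" B] by auto

lemma mass_finite: "finite A \<Longrightarrow> mass a A = (\<Sum>x\<in>A. \<bar>a x\<bar>)"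
  unfolding mass_def by simp

lemma infsum_Un_disjoint_ell1:
  "ell1 a \<Longrightarrow> A \<inter> B = {} \<Longrightarrow> infsum a (A \<union> B) = infsum a A + infsum a B"
  by (rule infsum_Un_disjoint) (auto intro: ell1_summable_on)

lemma abs_infsum_le_mass: "ell1 a \<Longrightarrow> \<bar>infsum a A\<bar> \<le> mass a A"
  unfolding mass_def using norm_infsum_bound[of a A] ell1_abs_summable_on[of a A] by simp

lemma mass_UN_le:
  assumes "ell1 a" "finite I"
  shows "mass a (\<Union>i\<in>I. A i) \<le> (\<Sum>i\<in>I. mass a (A i))"
  using assms(2)
proof (induction I rule: finite_induct)
  case empty
  thus ?case by (simp add: mass_finite)
next
  case (insert i I)
  thus ?case using mass_Un_le[OF assms(1), of "A i" "\<Union>i\<in>I. A i"] by simp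
qed

text \<open>All qualitative facts about tails come from this: up to \<open>e\<close>, an \<open>\<ell>\<^sub>1\<close> function is
  finitely supported. This is why the definition \<open>interpolating\<close> below has to deal with finite sets
  of points only.\<close>

lemma mass_concentrated:
  assumes "ell1 a" "0 < e"
  obtains V where "finite V" "mass a (- V) < e"
proof -
  have s: "(\<lambda>x. \<bar>a x\<bar>) summable_on UNIV" using assms(1) unfolding ell1_def .
  obtain V where V: "finite V" "dist (\<Sum>x\<in>V. \<bar>a x\<bar>) (mass a UNIV) \<le> e/2"
    using infsum_finite_approximation[OF s, of "e/2"] assms(2) unfolding mass_def by auto
  have "mass a UNIV = mass a V + mass a (- V)"
    using mass_Un_disjoint[OF assms(1), of V "- V"] by (simp add: Compl_partition)
  hence "mass a (- V) < e"
    using V assms(2) by (simp add: mass_finite dist_real_def)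
  thus thesis using V(1) that by blast
qed

lemma disjoint_family_avoids_finite:
  fixes B :: "nat \<Rightarrow> 'a set"
  assumes "disjoint_family B" "finite V"
  shows "\<exists>J. (\<Union>j\<in>{J..}. B j) \<inter> V = {}"
proof -
  have "\<exists>J. \<forall>j\<ge>J. x \<notin> B j" for x
  proof (cases "\<exists>i. x \<in> B i")
    case True
    then obtain i where i: "x \<in> B i" by blast
    have "x \<notin> B j" if "j \<ge> Suc i" for j
      using disjoint_family_onD[OF assms(1), of i j] i that by auto
    thus ?thesis by blast
  qed auto
  then obtain J where J: "\<And>x j. j \<ge> J x \<Longrightarrow> x \<notin> B j" by metis
  have "(\<Union>j\<in>{Max (insert 0 (J ` V))..}. B j) \<inter> V = {}"
  proof -
    have "x \<notin> B j" if "j \<ge> Max (insert 0 (J ` V))" "x \<in> V" for x j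
      using J that assms(2) by auto
    thus ?thesis by auto
  qed
  thus ?thesis by blast
qed

lemma mass_disjoint_tail:
  fixes B :: "nat \<Rightarrow> 'a set"
  assumes "ell1 a" "disjoint_family B" "0 < e"
  shows "\<exists>J. mass a (\<Union>j\<in>{J..}. B j) < e"
proof -
  obtain V where V: "finite V" "mass a (- V) < e" using mass_concentrated[OF assms(1,3)] .
  obtain J where "(\<Union>j\<in>{J..}. B j) \<inter> V = {}"
    using disjoint_family_avoids_finite[OF assms(2) V(1)] by blast
  hence "mass a (\<Union>j\<in>{J..}. B j) \<le> mass a (- V)"
    by (intro mass_mono[OF assms(1)]) auto
  hence "mass a (\<Union>j\<in>{J..}. B j) < e" using V(2) by linarith
  thus ?thesis by (rule exI)
qed

text \<open>One of the sets where \<open>a\<close> is nonnegative or negative carries at least half of the mass; this is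
  how a large variation is turned into a large value, at the price of a factor 2.\<close>

lemma mass_signed_finite_part:
  assumes "ell1 a" "e < mass a A" "0 \<le> e"
  shows "\<exists>T. finite T \<and> T \<subseteq> A \<and> e / 2 < \<bar>sum a T\<bar>"
proof -
  have "0 < mass a A - e" using assms(2) by simp
  then obtain V where V: "finite V" "mass a (- V) < mass a A - e"
    using mass_concentrated[OF assms(1)] by metis
  let ?V = "A \<inter> V"
  let ?P = "{x \<in> ?V. a x \<ge> 0}" and ?N = "{x \<in> ?V. a x < 0}"
  have "A = ?V \<union> (A - V)" by auto
  hence "mass a A \<le> mass a ?V + mass a (A - V)"
    using mass_Un_le[OF assms(1), of ?V "A - V"] by simp
  moreover have "mass a (A - V) \<le> mass a (- V)" by (rule mass_mono[OF assms(1)]) auto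
  ultimately have "e < (\<Sum>x\<in>?V. \<bar>a x\<bar>)" using V by (simp add: mass_finite)
  also have "(\<Sum>x\<in>?V. \<bar>a x\<bar>) = (\<Sum>x\<in>?P. \<bar>a x\<bar>) + (\<Sum>x\<in>?N. \<bar>a x\<bar>)"
    using V(1) by (subst sum.union_disjoint[symmetric]) (auto intro!: sum.cong)
  also have "(\<Sum>x\<in>?P. \<bar>a x\<bar>) = sum a ?P" by (rule sum.cong) auto
  also have "(\<Sum>x\<in>?N. \<bar>a x\<bar>) = - sum a ?N" by (simp add: sum_negf[symmetric])
  finally have "e / 2 < \<bar>sum a ?P\<bar> \<or> e / 2 < \<bar>sum a ?N\<bar>" by linarith
  thus ?thesis
  proof
    assume "e / 2 < \<bar>sum a ?P\<bar>"
    thus ?thesis using V(1) by (intro exI[of _ ?P]) auto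
  next
    assume "e / 2 < \<bar>sum a ?N\<bar>"
    thus ?thesis using V(1) by (intro exI[of _ ?N]) auto
  qed
qed

section \<open>Null sequences of summable functions on a point separating algebra\<close>

text \<open>The algebra stands for the clopen sets of a compact space. The gliding hump argument uses only
  that finitely many points can be separated by its members, so it is carried out without a
  topology.\<close>

locale point_separating_algebra = algebra +
  assumes separates: "x \<in> \<Omega> \<Longrightarrow> y \<in> \<Omega> \<Longrightarrow> x \<noteq> y \<Longrightarrow> \<exists>A\<in>M. x \<in> A \<and> y \<notin> A"
begin

lemma separates_point_finite:
  assumes "A \<in> M" "x \<in> A" "finite V" "x \<notin> V"
  shows "\<exists>U\<in>M. x \<in> U \<and> U \<subseteq> A \<and> U \<inter> V = {}"
  using assms(3,4)
proof (induction V rule: finite_induct)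
  case empty
  thus ?case using assms by auto
next
  case (insert y V)
  then obtain U where U: "U \<in> M" "x \<in> U" "U \<subseteq> A" "U \<inter> V = {}" by auto
  show ?case
  proof (cases "y \<in> \<Omega>")
    case True
    moreover have "x \<in> \<Omega>" using assms sets_into_space by auto
    ultimately obtain W where "W \<in> M" "x \<in> W" "y \<notin> W" using separates insert.prems by blast
    thus ?thesis using U by (intro bexI[of _ "U \<inter> W"]) auto
  next
    case False
    hence "y \<notin> U" using U sets_into_space by auto
    thus ?thesis using U by auto
  qed
qed

lemma separates_finite_finite:
  assumes "A \<in> M" "T \<subseteq> A" "finite T" "finite V" "T \<inter> V = {}"
  shows "\<exists>U\<in>M. T \<subseteq> U \<and> U \<subseteq> A \<and> U \<inter> V = {}"
proof -
  have "\<forall>x\<in>T. \<exists>U\<in>M. x \<in> U \<and> U \<subseteq> A \<and> U \<inter> V = {}"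
    using separates_point_finite assms by (metis disjoint_iff subsetD)
  then obtain U where U: "\<And>x. x \<in> T \<Longrightarrow> U x \<in> M \<and> x \<in> U x \<and> U x \<subseteq> A \<and> U x \<inter> V = {}"
    by metis
  have "(\<Union>x\<in>T. U x) \<in> M" using U assms(3) by (intro finite_UN) auto
  thus ?thesis using U by (intro bexI[of _ "\<Union>x\<in>T. U x"]) auto
qed

text \<open>The mass outside \<open>T\<close> is concentrated on finitely many points, and these can be separated from
  \<open>T\<close>; this replaces outer regularity.\<close>

lemma mass_shrink:
  assumes "ell1 a" "A \<in> M" "T \<subseteq> A" "finite T" "0 < e"
  shows "\<exists>U\<in>M. T \<subseteq> U \<and> U \<subseteq> A \<and> mass a (U - T) < e"
proof -
  obtain V where V: "finite V" "mass a (- V) < e" using mass_concentrated[OF assms(1,5)] .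
  obtain U where U: "U \<in> M" "T \<subseteq> U" "U \<subseteq> A" "U \<inter> (V - T) = {}"
    using separates_finite_finite[OF assms(2,3,4), of "V - T"] V by auto
  have "mass a (U - T) \<le> mass a (- V)" using U by (intro mass_mono[OF assms(1)]) auto
  thus ?thesis using U V by force
qed

end

text \<open>Uniform exhaustivity of the variations along disjoint sequences: the criterion of Dieudonne and
  Grothendieck for relative weak compactness.\<close>

definition uniformly_exhaustive :: "'a set set \<Rightarrow> (nat \<Rightarrow> 'a \<Rightarrow> real) \<Rightarrow> bool" where
  "uniformly_exhaustive M a \<longleftrightarrow>
     (\<forall>A :: nat \<Rightarrow> 'a set. range A \<subseteq> M \<longrightarrow> disjoint_family A \<longrightarrow>
        (\<forall>e>0. \<exists>j. \<forall>n. mass (a n) (A j) \<le> e))"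

text \<open>A weak form of the subsequential interpolation property of Boolean algebras. Two weakenings make
  it attainable in the quotient constructed later: each \<open>A j\<close> may first be shrunk to some \<open>B j\<close> around
  a given finite set, and \<open>C\<close> has to be a union of sets \<open>B j\<close> only as far as the countable set \<open>S\<close> can
  see. The sets \<open>B j\<close> are fixed before \<open>N\<close> and \<open>S\<close>, because the gliding hump needs a null sequence to
  converge on every \<open>B j\<close> before it can select the indices \<open>N\<close>.\<close>

definition interpolating :: "'a set set \<Rightarrow> bool" where
  "interpolating M \<longleftrightarrow>
     (\<forall>(A :: nat \<Rightarrow> 'a set) T. range A \<subseteq> M \<longrightarrow> disjoint_family A \<longrightarrow>
        (\<forall>j. finite (T j) \<and> T j \<subseteq> A j) \<longrightarrow>
        (\<exists>B. range B \<subseteq> M \<and> (\<forall>j. T j \<subseteq> B j \<and> B j \<subseteq> A j) \<and>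
           (\<forall>N S. infinite N \<longrightarrow> countable S \<longrightarrow>
              (\<exists>I C. infinite I \<and> I \<subseteq> N \<and> C \<in> M \<and> C \<inter> S = (\<Union>j\<in>I. B j) \<inter> S))))"

context point_separating_algebra
begin

lemma uniformly_exhaustive_increasing:
  assumes ue: "uniformly_exhaustive M a" and e: "0 < e"
    and W: "range W \<subseteq> M" "\<And>j. W j \<subseteq> W (Suc j)"
  shows "\<exists>j. \<forall>n. mass (a n) (W (Suc j) - W j) \<le> e"
proof -
  have "range (\<lambda>j. W (Suc j) - W j) \<subseteq> M" using W by auto
  moreover have "disjoint_family (\<lambda>j. W (Suc j) - W j)"
    using W(2) by (intro disjoint_family_Suc)
  ultimately show ?thesis using ue e unfolding uniformly_exhaustive_def by meson
qed

text \<open>Otherwise one could peel off, from any neighbourhood of \<open>x\<close>, a disjoint piece on which some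
  \<open>a n\<close> has mass at least \<open>e/2\<close>, leaving a smaller neighbourhood of \<open>x\<close>, and go on for ever.\<close>

lemma uniformly_exhaustive_point:
  assumes l1: "\<And>n. ell1 (a n)" and ue: "uniformly_exhaustive M a"
    and x: "x \<in> \<Omega>" and e: "0 < e"
  shows "\<exists>U\<in>M. x \<in> U \<and> (\<forall>n. mass (a n) (U - {x}) \<le> e)"
proof (rule ccontr)
  assume neg: "\<not> ?thesis"
  have step: "\<exists>U'. (U' \<in> M \<and> x \<in> U') \<and> (U' \<subseteq> U \<and> (\<exists>n. e/2 < mass (a n) (U - U')))"
    if U: "U \<in> M \<and> x \<in> U" for U
  proof -
    obtain n where n: "e < mass (a n) (U - {x})" using neg U by (auto simp: not_le)
    obtain V where V: "finite V" "mass (a n) (- V) < e/2"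
      using mass_concentrated[OF l1[of n], of "e/2"] e by auto
    obtain U' where U': "U' \<in> M" "x \<in> U'" "U' \<subseteq> U" "U' \<inter> (V - {x}) = {}"
      using separates_point_finite[of U x "V - {x}"] U V by auto
    have "U - {x} \<subseteq> (U - U') \<union> (- V)" using U' by auto
    hence "mass (a n) (U - {x}) \<le> mass (a n) ((U - U') \<union> (- V))" using mass_mono l1 by blast
    also have "\<dots> \<le> mass (a n) (U - U') + mass (a n) (- V)" using mass_Un_le l1 by blast
    finally have "e/2 < mass (a n) (U - U')" using n V by linarith
    thus ?thesis using U' by blast
  qed
  obtain U where U: "\<And>j::nat. U j \<in> M \<and> x \<in> U j"
    "\<And>j. U (Suc j) \<subseteq> U j \<and> (\<exists>n. e/2 < mass (a n) (U j - U (Suc j)))"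
    using dependent_nat_choice[of "\<lambda>_ U. U \<in> M \<and> x \<in> U"
        "\<lambda>_ U U'. U' \<subseteq> U \<and> (\<exists>n. e/2 < mass (a n) (U - U'))"] step x top by metis
  have "(\<Omega> - U (Suc j)) - (\<Omega> - U j) = U j - U (Suc j)" for j
    using U sets_into_space by blast
  moreover have "\<exists>j. \<forall>n. mass (a n) ((\<Omega> - U (Suc j)) - (\<Omega> - U j)) \<le> e/2"
    using U e by (intro uniformly_exhaustive_increasing[OF ue]) (auto simp: image_subset_iff)
  ultimately show False using U(2) by (metis not_le)
qed

text \<open>Convergence at a single point follows from convergence on a neighbourhood with uniformly small
  remaining mass. If the norms did not tend to 0, choose such neighbourhoods \<open>U i\<close> of the points
  \<open>x\<^sub>i\<close> of \<open>S\<close>, with remaining masses summing to at most \<open>e/4\<close>. On the finite union \<open>W N\<close> the masses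
  of \<open>a n\<close> are then eventually below \<open>e/2\<close>, whereas \<open>W N'\<close> captures almost all of the mass of \<open>a n\<close> when
  \<open>N'\<close> is large. So the increments of the increasing sequence \<open>W\<close> keep carrying mass, against uniform
  exhaustivity.\<close>

lemma uniformly_exhaustive_mass_tendsto:
  assumes l1: "\<And>n. ell1 (a n)" and ue: "uniformly_exhaustive M a"
    and S: "countable S" "S \<subseteq> \<Omega>" "\<And>n x. x \<notin> S \<Longrightarrow> a n x = 0"
    and null: "\<And>A. A \<in> M \<Longrightarrow> (\<lambda>n. infsum (a n) A) \<longlonglongrightarrow> 0"
  shows "(\<lambda>n. mass (a n) UNIV) \<longlonglongrightarrow> 0"
proof (cases "S = {}")
  case True
  hence "mass (a n) UNIV = 0" for n using S(3) unfolding mass_def by (simp add: infsum_0)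
  thus ?thesis by simp
next
  case False
  let ?x = "from_nat_into S"
  have xS: "?x i \<in> S" for i using from_nat_into[OF False] .
  have pointwise: "(\<lambda>n. a n x) \<longlonglongrightarrow> 0" if x: "x \<in> \<Omega>" for x
  proof (rule LIMSEQ_I)
    fix e :: real assume e: "0 < e"
    obtain U where U: "U \<in> M" "x \<in> U" "\<And>n. mass (a n) (U - {x}) \<le> e/2"
      using uniformly_exhaustive_point[OF l1 ue x, of "e/2"] e by auto
    obtain n0 where n0: "\<And>n. n \<ge> n0 \<Longrightarrow> \<bar>infsum (a n) U\<bar> < e/2"
      using LIMSEQ_D[OF null[OF U(1)], of "e/2"] e by auto
    have "\<bar>a n x\<bar> < e" if "n \<ge> n0" for n
    proof -
      have "infsum (a n) U = a n x + infsum (a n) (U - {x})"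
        using infsum_Un_disjoint_ell1[OF l1, of "{x}" "U - {x}" n] U(2)
        by (simp add: insert_absorb)
      moreover have "\<bar>infsum (a n) (U - {x})\<bar> \<le> e/2"
        using abs_infsum_le_mass[OF l1, of n "U - {x}"] U(3)[of n] by linarith
      ultimately show ?thesis using n0[OF that] by linarith
    qed
    thus "\<exists>n0. \<forall>n\<ge>n0. norm (a n x - 0) < e" by auto
  qed
  show ?thesis
  proof (rule ccontr)
    assume "\<not> ?thesis"
    then obtain e where e: "0 < e" "\<And>n0. \<exists>n\<ge>n0. e \<le> mass (a n) UNIV"
      unfolding LIMSEQ_iff by (auto simp: not_less abs_of_nonneg[OF mass_nonneg])
    have "\<exists>U\<in>M. ?x i \<in> U \<and> (\<forall>n. mass (a n) (U - {?x i}) \<le> e/8 * (1/2)^i)" for i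
      using e S xS by (intro uniformly_exhaustive_point[OF l1 ue]) auto
    then obtain U where U: "\<And>i. U i \<in> M" "\<And>i. ?x i \<in> U i"
      "\<And>i n. mass (a n) (U i - {?x i}) \<le> e/8 * (1/2)^i" by metis
    define W where "W N = (\<Union>i<N. U i)" for N
    have WM: "W N \<in> M" for N unfolding W_def using U by (intro finite_UN) auto
    have W_mono: "W m \<subseteq> W N" if "m \<le> N" for m N unfolding W_def using that by force
    have W_le: "mass (a n) (W N) \<le> (\<Sum>i<N. \<bar>a n (?x i)\<bar>) + e/4" for n N
    proof -
      have "mass (a n) (U i) \<le> \<bar>a n (?x i)\<bar> + e/8 * (1/2)^i" for i
      proof -
        have "mass (a n) (U i) = mass (a n) {?x i} + mass (a n) (U i - {?x i})"
          using mass_Un_disjoint[OF l1, of "{?x i}" "U i - {?x i}" n] U(2)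
          by (simp add: insert_absorb)
        thus ?thesis using U(3)[of n i] by (simp add: mass_finite)
      qed
      hence "mass (a n) (W N) \<le> (\<Sum>i<N. \<bar>a n (?x i)\<bar> + e/8 * (1/2)^i)"
        unfolding W_def using mass_UN_le[OF l1, of "{..<N}" n U]
        by (meson finite_lessThan order_trans sum_mono)
      also have "\<dots> = (\<Sum>i<N. \<bar>a n (?x i)\<bar>) + e/8 * (\<Sum>i<N. (1/2)^i)"
        by (simp add: sum.distrib sum_distrib_left)
      also have "(\<Sum>i<N. (1/2::real)^i) \<le> 2"
        using geometric_sum_less[of "1/2::real" "{..<N}"] by simp
      finally show ?thesis using e(1) by (simp add: mult_left_mono)
    qed
    have step: "\<exists>N'>N. \<exists>n. e/8 < mass (a n) (W N' - W N)" for N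
    proof -
      have "(\<lambda>n. \<Sum>i<N. \<bar>a n (?x i)\<bar>) \<longlonglongrightarrow> (\<Sum>i<N. \<bar>0\<bar>)"
        using S xS by (intro tendsto_sum tendsto_rabs pointwise) auto
      hence "\<forall>\<^sub>F n in sequentially. (\<Sum>i<N. \<bar>a n (?x i)\<bar>) < e/4"
        using e(1) by (intro order_tendstoD(2)) auto
      then obtain n where n: "(\<Sum>i<N. \<bar>a n (?x i)\<bar>) < e/4" "e \<le> mass (a n) UNIV"
        unfolding eventually_sequentially using e(2) by meson
      obtain V where V: "finite V" "mass (a n) (- V) < e/4"
        using mass_concentrated[OF l1, of "e/4" n] e(1) by auto
      define N' where "N' = Suc (Max (insert N (to_nat_on S ` V)))"
      have N': "N < N'" "\<And>x. x \<in> V \<Longrightarrow> to_nat_on S x < N'"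
        unfolding N'_def using V(1) by (auto simp: less_Suc_eq_le)
      have "V \<inter> S \<subseteq> W N'"
      proof
        fix x assume x: "x \<in> V \<inter> S"
        hence "x = ?x (to_nat_on S x)" using S(1) by simp
        thus "x \<in> W N'" unfolding W_def using U(2)[of "to_nat_on S x"] N'(2)[of x] x by auto
      qed
      have "mass (a n) UNIV = mass (a n) S"
        unfolding mass_def using S(3) by (intro infsum_cong_neutral) auto
      also have "\<dots> \<le> mass (a n) ((W N' - W N) \<union> (W N \<union> (- V)))"
        using \<open>V \<inter> S \<subseteq> W N'\<close> by (intro mass_mono[OF l1]) auto
      also have "\<dots> \<le> mass (a n) (W N' - W N) + mass (a n) (W N \<union> (- V))"
        by (rule mass_Un_le[OF l1])
      also have "mass (a n) (W N \<union> (- V)) \<le> mass (a n) (W N) + mass (a n) (- V)"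
        by (rule mass_Un_le[OF l1])
      finally have "e/8 < mass (a n) (W N' - W N)" using n V(2) W_le[of n N] e(1) by linarith
      thus ?thesis using N'(1) by blast
    qed
    then obtain g where g: "\<And>N. g N > N" "\<And>N. \<exists>n. e/8 < mass (a n) (W (g N) - W N)" by metis
    define s where "s j = (g ^^ j) 0" for j
    have "\<exists>j. \<forall>n. mass (a n) (W (s (Suc j)) - W (s j)) \<le> e/8"
      using WM W_mono g(1) e(1) unfolding s_def
      by (intro uniformly_exhaustive_increasing[OF ue]) (auto simp: less_imp_le)
    thus False using g(2) unfolding s_def by (auto simp: not_le[symmetric])
  qed
qed

text \<open>The gliding hump. If disjoint sets \<open>A j\<close> carry mass more than \<open>e\<close> of \<open>a (n j)\<close>, a finite part
  \<open>T j\<close> of \<open>A j\<close> has a value of modulus more than \<open>e/2\<close>, and it keeps \<open>3*e/8\<close> on any set between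
  \<open>T j\<close> and a small neighbourhood \<open>A' j\<close>; in particular on the sets \<open>B j\<close> given by interpolation.
  Thin out the indices to \<open>N\<close> such that the \<open>j\<close>-th hump sees less than \<open>e/8\<close> of the earlier \<open>B i\<close> and
  less than \<open>e/8\<close> of the later ones. An interpolating set \<open>C\<close> then has \<open>\<bar>infsum (a (n j)) C\<bar> > e/8\<close> for
  infinitely many \<open>j\<close>.\<close>

lemma interpolating_uniformly_exhaustive:
  assumes l1: "\<And>n. ell1 (a n)" and int: "interpolating M"
    and S: "countable S" "\<And>n x. x \<notin> S \<Longrightarrow> a n x = 0"
    and null: "\<And>A. A \<in> M \<Longrightarrow> (\<lambda>n. infsum (a n) A) \<longlonglongrightarrow> 0"
  shows "uniformly_exhaustive M a"
proof (rule ccontr)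
  assume "\<not> ?thesis"
  then obtain A :: "nat \<Rightarrow> 'a set" and e where A: "range A \<subseteq> M" "disjoint_family A" "0 < e"
    "\<And>j. \<exists>n. e < mass (a n) (A j)"
    unfolding uniformly_exhaustive_def by (auto simp: not_le)
  then obtain n where n: "\<And>j. e < mass (a (n j)) (A j)" by metis
  \<comment> \<open>A fixed \<open>a k\<close> has small mass on all but finitely many of the disjoint sets \<open>A j\<close>.\<close>
  have n_lim: "filterlim n at_top sequentially"
  proof -
    have "\<forall>\<^sub>F j in sequentially. n j \<noteq> k" for k
    proof -
      obtain J where J: "mass (a k) (\<Union>j\<in>{J..}. A j) < e"
        using mass_disjoint_tail[OF l1 A(2,3)] by blast
      have "n j \<noteq> k" if "j \<ge> J" for j
        using n[of j] J mass_mono[OF l1, of "A j" "\<Union>j\<in>{J..}. A j" k] that by force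
      thus ?thesis unfolding eventually_sequentially by blast
    qed
    hence ev: "\<forall>\<^sub>F j in sequentially. \<forall>k\<in>{..<K}. n j \<noteq> k" for K
      by (subst eventually_ball_finite_distrib) auto
    show ?thesis unfolding filterlim_at_top
      by (intro allI eventually_mono[OF ev]) (auto simp: not_less[symmetric])
  qed
  have "\<exists>T. finite T \<and> T \<subseteq> A j \<and> e / 2 < \<bar>sum (a (n j)) T\<bar>" for j
    using mass_signed_finite_part[OF l1 n] A(3) by simp
  then obtain T where T: "\<And>j. finite (T j)" "\<And>j. T j \<subseteq> A j"
    "\<And>j. e / 2 < \<bar>sum (a (n j)) (T j)\<bar>" by metis
  have "\<exists>U\<in>M. T j \<subseteq> U \<and> U \<subseteq> A j \<and> mass (a (n j)) (U - T j) < e/8" for j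
    using T A by (intro mass_shrink[OF l1]) auto
  then obtain A' where A': "\<And>j. A' j \<in> M" "\<And>j. T j \<subseteq> A' j" "\<And>j. A' j \<subseteq> A j"
    "\<And>j. mass (a (n j)) (A' j - T j) < e/8" by metis
  have "disjoint_family A'" using A(2) A'(3) by (meson disjoint_family_subset)
  then obtain B where B: "range B \<subseteq> M" "\<And>j. T j \<subseteq> B j" "\<And>j. B j \<subseteq> A' j"
    and BC: "\<And>N S. infinite N \<Longrightarrow> countable S \<Longrightarrow>
              \<exists>I C. infinite I \<and> I \<subseteq> N \<and> C \<in> M \<and> C \<inter> S = (\<Union>j\<in>I. B j) \<inter> S"
    using int[unfolded interpolating_def, rule_format, of A' T] A' T(1) by (auto simp: image_subset_iff)
  have Bdisj: "disjoint_family B" using A(2) A'(3) B(3) by (meson disjoint_family_subset order_trans)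
  have Blarge: "3 * e / 8 < \<bar>infsum (a (n j)) (B j)\<bar>" for j
  proof -
    have "infsum (a (n j)) (T j \<union> (B j - T j)) = infsum (a (n j)) (T j) + infsum (a (n j)) (B j - T j)"
      by (rule infsum_Un_disjoint_ell1[OF l1]) auto
    hence "infsum (a (n j)) (B j) = sum (a (n j)) (T j) + infsum (a (n j)) (B j - T j)"
      using B(2)[of j] T(1) by (simp add: Un_absorb1)
    moreover have "\<bar>infsum (a (n j)) (B j - T j)\<bar> \<le> mass (a (n j)) (A' j - T j)"
      using abs_infsum_le_mass[OF l1, of "n j" "B j - T j"]
        mass_mono[OF l1, of "B j - T j" "A' j - T j" "n j"] B(3)[of j] by force
    ultimately show ?thesis using T(3)[of j] A'(4)[of j] by linarith
  qed
  have step: "\<exists>J'>J. (\<forall>j\<ge>J'. (\<Sum>i\<le>J. \<bar>infsum (a (n j)) (B i)\<bar>) < e/8) \<and>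
                mass (a (n J)) (\<Union>j\<in>{J'..}. B j) < e/8" for J
  proof -
    have "(\<lambda>j. \<Sum>i\<le>J. \<bar>infsum (a (n j)) (B i)\<bar>) \<longlonglongrightarrow> (\<Sum>i\<le>J. \<bar>0\<bar>)"
      using B(1) by (intro tendsto_sum tendsto_rabs filterlim_compose[OF null n_lim]) auto
    hence "\<forall>\<^sub>F j in sequentially. (\<Sum>i\<le>J. \<bar>infsum (a (n j)) (B i)\<bar>) < e/8"
      using A(3) by (intro order_tendstoD(2)) auto
    then obtain J1 where J1: "\<And>j. j \<ge> J1 \<Longrightarrow> (\<Sum>i\<le>J. \<bar>infsum (a (n j)) (B i)\<bar>) < e/8"
      unfolding eventually_sequentially by blast
    obtain J2 where J2: "mass (a (n J)) (\<Union>j\<in>{J2..}. B j) < e/8"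
      using mass_disjoint_tail[OF l1 Bdisj, of "e/8" "n J"] A(3) by auto
    let ?J = "max (Suc J) (max J1 J2)"
    have "mass (a (n J)) (\<Union>j\<in>{?J..}. B j) \<le> mass (a (n J)) (\<Union>j\<in>{J2..}. B j)"
      by (intro mass_mono[OF l1]) auto
    thus ?thesis using J1 J2 by (intro exI[of _ ?J]) auto
  qed
  \<comment> \<open>From index \<open>J\<close> the selection may jump to any index from \<open>g J\<close> on.\<close>
  then obtain g where g: "\<And>J. g J > J"
    "\<And>J j. j \<ge> g J \<Longrightarrow> (\<Sum>i\<le>J. \<bar>infsum (a (n j)) (B i)\<bar>) < e/8"
    "\<And>J. mass (a (n J)) (\<Union>j\<in>{g J..}. B j) < e/8" by metis
  define s where "s j = (g ^^ j) 0" for j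
  have s_mono: "strict_mono s"
    unfolding s_def using g(1) by (intro strict_monoI_Suc) simp
  obtain I C where I: "infinite I" "I \<subseteq> range s" "C \<in> M" "C \<inter> S = (\<Union>j\<in>I. B j) \<inter> S"
    using BC[OF _ S(1), of "range s"] s_mono strict_mono_imp_inj_on range_inj_infinite by blast
  have Clarge: "e/8 < \<bar>infsum (a (n j)) C\<bar>" if j: "j \<in> I" for j
  proof -
    obtain l where l: "j = s l" using I(2) j by auto
    let ?a = "a (n j)"
    define X where "X = (\<Union>i\<in>{i\<in>I. i < j}. B i)"
    define Y where "Y = (\<Union>i\<in>{i\<in>I. i > j}. B i)"
    have dj: "B i \<inter> B k = {}" if "i \<noteq> k" for i k
      using Bdisj that unfolding disjoint_family_on_def by auto
    have "infsum ?a C = infsum ?a (C \<inter> S)" using S(2) by (intro infsum_cong_neutral) auto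
    also have "\<dots> = infsum ?a ((\<Union>j\<in>I. B j) \<inter> S)" using I by simp
    also have "\<dots> = infsum ?a (\<Union>j\<in>I. B j)" using S(2) by (intro infsum_cong_neutral) auto
    also have "(\<Union>j\<in>I. B j) = (B j \<union> X) \<union> Y"
    proof -
      have "x \<in> (B j \<union> X) \<union> Y" if "i \<in> I" "x \<in> B i" for i x
        using that by (cases i j rule: linorder_cases) (auto simp: X_def Y_def)
      thus ?thesis using j by (auto simp: X_def Y_def)
    qed
    also have "infsum ?a \<dots> = infsum ?a (B j) + infsum ?a X + infsum ?a Y"
    proof -
      have 1: "B i \<inter> B k = {}" if "i \<le> j" "k > j" for i k using dj[of i k] that by simp
      have 2: "B j \<inter> B k = {}" if "k < j" for k using dj[of j k] that by simp
      have 3: "B i \<inter> Y = {}" if "i \<le> j" for i unfolding Y_def using 1[OF that] by blast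
      have "X \<inter> Y = {}"
      proof -
        have "B i \<inter> Y = {}" if "i < j" for i using 3 that by simp
        thus ?thesis unfolding X_def by blast
      qed
      hence "(B j \<union> X) \<inter> Y = {}" using 3[of j] by blast
      moreover have "B j \<inter> X = {}" unfolding X_def using 2 by blast
      ultimately show ?thesis by (simp add: infsum_Un_disjoint_ell1[OF l1])
    qed
    finally have eq: "infsum ?a C = infsum ?a (B j) + infsum ?a X + infsum ?a Y" .
    have "\<bar>infsum ?a X\<bar> < e/8"
    proof (cases l)
      case 0
      hence "X = {}" unfolding X_def using l by (auto simp: s_def)
      thus ?thesis using A(3) by simp
    next
      case (Suc k)
      have le: "{i\<in>I. i < j} \<subseteq> {..s k}"
      proof
        fix i assume "i \<in> {i\<in>I. i < j}"
        then obtain k' where k': "i = s k'" "s k' < s (Suc k)" using I(2) l Suc by blast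
        hence "k' \<le> k" using s_mono by (simp add: strict_mono_less less_Suc_eq_le)
        thus "i \<in> {..s k}" using k' s_mono by (simp add: strict_mono_less_eq)
      qed
      have fin: "finite {i\<in>I. i < j}" by (rule finite_subset[OF le finite_atMost])
      have "infsum ?a (\<Union>i\<in>F. B i) = (\<Sum>i\<in>F. infsum ?a (B i))" if "finite F" for F
        using that
      proof (induction rule: finite_induct)
        case (insert i F)
        have "B i \<inter> B k = {}" if "k \<in> F" for k using dj[of i k] insert.hyps(2) that by blast
        hence "B i \<inter> \<Union> (B ` F) = {}" by blast
        thus ?case using insert by (simp add: infsum_Un_disjoint_ell1[OF l1])
      qed simp
      from this[OF fin] have "infsum ?a X = (\<Sum>i\<in>{i\<in>I. i < j}. infsum ?a (B i))"
        unfolding X_def .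
      hence "\<bar>infsum ?a X\<bar> \<le> (\<Sum>i\<in>{i\<in>I. i < j}. \<bar>infsum ?a (B i)\<bar>)" by simp
      also have "\<dots> \<le> (\<Sum>i\<le>s k. \<bar>infsum ?a (B i)\<bar>)" using le by (intro sum_mono2) auto
      also have "\<dots> < e/8" by (intro g(2)) (simp add: l Suc s_def)
      finally show ?thesis .
    qed
    moreover have "\<bar>infsum ?a Y\<bar> < e/8"
    proof -
      have "i \<ge> g j" if i: "i \<in> I" "i > j" for i
      proof -
        obtain k where k: "i = s k" "s l < s k" using I(2) i l by blast
        hence "Suc l \<le> k" using s_mono by (simp add: strict_mono_less Suc_le_eq)
        hence "s (Suc l) \<le> i" using k s_mono by (simp add: strict_mono_less_eq)
        thus ?thesis unfolding l s_def by simp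
      qed
      hence "Y \<subseteq> (\<Union>i\<in>{g j..}. B i)" unfolding Y_def by auto
      hence "mass ?a Y < e/8" using g(3)[of j] mass_mono[OF l1] by (meson le_less_trans)
      thus ?thesis using abs_infsum_le_mass[OF l1, of "n j" Y] by linarith
    qed
    ultimately show ?thesis using eq Blarge[of j] by linarith
  qed
  have "(\<lambda>j. infsum (a (n j)) C) \<longlonglongrightarrow> 0" by (rule filterlim_compose[OF null[OF I(3)] n_lim])
  hence "\<forall>\<^sub>F j in sequentially. \<bar>infsum (a (n j)) C\<bar> < e/8"
    using A(3) by (intro order_tendstoD(2)[OF tendsto_rabs_zero]) auto
  then obtain J where "\<And>j. j \<ge> J \<Longrightarrow> \<bar>infsum (a (n j)) C\<bar> < e/8"
    unfolding eventually_sequentially by blast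
  moreover obtain j where "j \<in> I" "j \<ge> J" using I(1) by (meson infinite_nat_iff_unbounded_le)
  ultimately show False using Clarge by force
qed

text \<open>A sequence that converges on the algebra is Cauchy in norm: the differences \<open>b (m N) - b (n N)\<close>
  with \<open>m N\<close> and \<open>n N\<close> tending to infinity converge to 0 on the algebra. This is where the Schur property
  of \<open>\<ell>\<^sub>1\<close> shows.\<close>

lemma interpolating_ell1_Cauchy:
  assumes l1: "\<And>n. ell1 (b n)" and int: "interpolating M"
    and S: "countable S" "S \<subseteq> \<Omega>" "\<And>n x. x \<notin> S \<Longrightarrow> b n x = 0"
    and conv: "\<And>A. A \<in> M \<Longrightarrow> convergent (\<lambda>n. infsum (b n) A)"
    and e: "0 < e"
  shows "\<exists>N. \<forall>m\<ge>N. \<forall>n\<ge>N. mass (\<lambda>x. b m x - b n x) UNIV < e"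
proof (rule ccontr)
  assume "\<not> ?thesis"
  then obtain m n where mn: "\<And>N. m N \<ge> N" "\<And>N. n N \<ge> N"
    "\<And>N. e \<le> mass (\<lambda>x. b (m N) x - b (n N) x) UNIV"
    unfolding not_ex not_all not_imp not_less by metis
  define a where "a N = (\<lambda>x. b (m N) x - b (n N) x)" for N
  have a1: "ell1 (a N)" for N unfolding a_def by (intro ell1_diff l1)
  have a0: "a N x = 0" if "x \<notin> S" for N x unfolding a_def using S(3)[OF that] by simp
  have lim: "filterlim m at_top sequentially" "filterlim n at_top sequentially"
    using mn by (auto intro!: filterlim_at_top_mono[OF filterlim_ident])
  have null: "(\<lambda>N. infsum (a N) A) \<longlonglongrightarrow> 0" if A: "A \<in> M" for A
  proof -
    obtain l where l: "(\<lambda>n. infsum (b n) A) \<longlonglongrightarrow> l" using conv[OF A] unfolding convergent_def by blast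
    have "(\<lambda>N. infsum (b (m N)) A - infsum (b (n N)) A) \<longlonglongrightarrow> l - l"
      by (intro tendsto_diff filterlim_compose[OF l] lim)
    thus ?thesis unfolding a_def by (simp add: infsum_ell1_diff[OF l1 l1])
  qed
  have "uniformly_exhaustive M a"
    by (rule interpolating_uniformly_exhaustive[OF a1 int S(1) a0 null])
  hence "(\<lambda>N. mass (a N) UNIV) \<longlonglongrightarrow> 0"
    by (rule uniformly_exhaustive_mass_tendsto[OF a1 _ S(1,2) a0 null])
  hence "\<forall>\<^sub>F N in sequentially. mass (a N) UNIV < e" by (rule order_tendstoD(2)) (rule e)
  thus False using mn(3) unfolding a_def eventually_sequentially by (meson le_refl not_le)
qed

end

lemma ell1_complete:
  assumes l1: "\<And>n. ell1 (b n)"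
    and cauchy: "\<And>e. 0 < e \<Longrightarrow> \<exists>N. \<forall>m\<ge>N. \<forall>n\<ge>N. mass (\<lambda>x. b m x - b n x) UNIV < e"
  shows "\<exists>c. ell1 c \<and> (\<forall>x. (\<lambda>n. b n x) \<longlonglongrightarrow> c x) \<and> (\<forall>A. (\<lambda>n. infsum (b n) A) \<longlonglongrightarrow> infsum c A)"
proof -
  have d1: "ell1 (\<lambda>x. b m x - b n x)" for m n by (intro ell1_diff l1)
  have pt: "(\<Sum>x\<in>V. \<bar>b m x - b n x\<bar>) \<le> mass (\<lambda>x. b m x - b n x) UNIV" if "finite V" for V m n
    using mass_mono[OF d1, of V UNIV] that by (simp add: mass_finite)
  have "Cauchy (\<lambda>n. b n x)" for x
  proof (rule CauchyI)
    fix e :: real assume "0 < e"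
    then obtain N where N: "\<forall>m\<ge>N. \<forall>n\<ge>N. mass (\<lambda>x. b m x - b n x) UNIV < e"
      using cauchy by blast
    have "norm (b m x - b n x) < e" if "m \<ge> N" "n \<ge> N" for m n
      using pt[of "{x}" m n] N[rule_format, OF that] by simp
    thus "\<exists>N. \<forall>m\<ge>N. \<forall>n\<ge>N. norm (b m x - b n x) < e" by blast
  qed
  hence "\<exists>c. (\<lambda>n. b n x) \<longlonglongrightarrow> c" for x by (simp add: Cauchy_convergent_iff convergent_def)
  then obtain c where c: "\<And>x. (\<lambda>n. b n x) \<longlonglongrightarrow> c x" by metis
  have bound: "\<exists>N. \<forall>n\<ge>N. \<forall>V. finite V \<longrightarrow> (\<Sum>x\<in>V. \<bar>b n x - c x\<bar>) \<le> e" if e: "0 < e" for e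
  proof -
    obtain N where N: "\<And>m n. m \<ge> N \<Longrightarrow> n \<ge> N \<Longrightarrow> mass (\<lambda>x. b m x - b n x) UNIV < e"
      using cauchy[OF e] by blast
    have "(\<Sum>x\<in>V. \<bar>b n x - c x\<bar>) \<le> e" if "n \<ge> N" "finite V" for n V
    proof (rule tendsto_upperbound)
      show "(\<lambda>m. \<Sum>x\<in>V. \<bar>b n x - b m x\<bar>) \<longlonglongrightarrow> (\<Sum>x\<in>V. \<bar>b n x - c x\<bar>)"
        by (intro tendsto_intros c)
      show "\<forall>\<^sub>F m in sequentially. (\<Sum>x\<in>V. \<bar>b n x - b m x\<bar>) \<le> e"
        unfolding eventually_sequentially
        using N[OF that(1)] pt[OF that(2), of n] by (meson less_imp_le order_trans)
    qed simp
    thus ?thesis by blast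
  qed
  have dc1: "ell1 (\<lambda>x. b n x - c x) \<and> mass (\<lambda>x. b n x - c x) UNIV \<le> e"
    if "\<forall>V. finite V \<longrightarrow> (\<Sum>x\<in>V. \<bar>b n x - c x\<bar>) \<le> e" for n e
  proof
    show s: "ell1 (\<lambda>x. b n x - c x)"
      unfolding ell1_def using that
      by (intro nonneg_bdd_above_summable_on bdd_aboveI2[where M = e]) auto
    show "mass (\<lambda>x. b n x - c x) UNIV \<le> e"
      unfolding mass_def using s that by (intro infsum_le_finite_sums) (auto simp: ell1_def)
  qed
  have c1: "ell1 c"
  proof -
    obtain n where "ell1 (\<lambda>x. b n x - c x)" using bound[of 1] dc1 by (metis le_refl zero_less_one)
    from ell1_diff[OF l1[of n] this] show ?thesis by simp
  qed
  have "(\<lambda>n. infsum (b n) A) \<longlonglongrightarrow> infsum c A" for A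
  proof (rule LIMSEQ_I)
    fix e :: real assume "0 < e"
    then obtain N where N: "\<And>n V. n \<ge> N \<Longrightarrow> finite V \<Longrightarrow> (\<Sum>x\<in>V. \<bar>b n x - c x\<bar>) \<le> e/2"
      using bound[of "e/2"] by auto
    have "\<bar>infsum (b n) A - infsum c A\<bar> < e" if "n \<ge> N" for n
    proof -
      note * = dc1[of n "e/2"]
      have "\<bar>infsum (b n) A - infsum c A\<bar> = \<bar>\<Sum>\<^sub>\<infinity>x\<in>A. b n x - c x\<bar>"
        by (simp add: infsum_ell1_diff[OF l1 c1])
      also have "\<dots> \<le> mass (\<lambda>x. b n x - c x) A" using * N[OF that] by (intro abs_infsum_le_mass) auto
      also have "\<dots> \<le> mass (\<lambda>x. b n x - c x) UNIV" using * N[OF that] by (intro mass_mono) auto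
      also have "\<dots> \<le> e/2" using * N[OF that] by auto
      finally show ?thesis using \<open>0 < e\<close> by linarith
    qed
    thus "\<exists>N. \<forall>n\<ge>N. norm (infsum (b n) A - infsum c A) < e" by auto
  qed
  thus ?thesis using c c1 by blast
qed

section \<open>Clopen sets and Borel sets\<close>

definition clopens :: "'a topology \<Rightarrow> 'a set set" where
  "clopens X = {A. openin X A \<and> closedin X A}"

definition clopen_separated :: "'a topology \<Rightarrow> bool" where
  "clopen_separated X \<longleftrightarrow>
     (\<forall>x\<in>topspace X. \<forall>y\<in>topspace X. x \<noteq> y \<longrightarrow> (\<exists>A\<in>clopens X. x \<in> A \<and> y \<notin> A))"

lemma algebra_clopens: "algebra (topspace X) (clopens X)"
  unfolding algebra_iff_Un by (auto simp: clopens_def dest: openin_subset intro: openin_diff closedin_diff)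

lemma clopen_separated_algebra:
  "clopen_separated X \<Longrightarrow> point_separating_algebra (topspace X) (clopens X)"
  by (intro point_separating_algebra.intro algebra_clopens point_separating_algebra_axioms.intro)
    (auto simp: clopen_separated_def)

lemma clopen_separated_Hausdorff:
  assumes "clopen_separated X"
  shows "Hausdorff_space X"
  unfolding Hausdorff_space_def
proof (intro allI impI)
  fix x y assume xy: "x \<in> topspace X \<and> y \<in> topspace X \<and> x \<noteq> y"
  then obtain A where A: "A \<in> clopens X" "x \<in> A" "y \<notin> A"
    using assms unfolding clopen_separated_def by blast
  thus "\<exists>U V. openin X U \<and> openin X V \<and> x \<in> U \<and> y \<in> V \<and> disjnt U V"
    using xy by (intro exI[of _ A] exI[of _ "topspace X - A"]) (auto simp: clopens_def disjnt_def)
qed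

lemma space_borel_of [simp]: "space (borel_of X) = topspace X"
  unfolding borel_of_def by (rule space_measure_of) (auto dest: openin_subset)

lemma sets_borel_of: "sets (borel_of X) = sigma_sets (topspace X) {U. openin X U}"
  unfolding borel_of_def by (rule sets_measure_of) (auto dest: openin_subset)

lemma borel_of_open: "openin X U \<Longrightarrow> U \<in> sets (borel_of X)"
  unfolding sets_borel_of by (rule sigma_sets.Basic) simp

lemma borel_of_closed: "closedin X C \<Longrightarrow> C \<in> sets (borel_of X)"
  using sets.compl_sets[OF borel_of_open[of X "topspace X - C"]]
  by (auto simp: closedin_def double_diff)

lemma borel_of_topspace [simp]: "topspace X \<in> sets (borel_of X)"
  by (rule borel_of_open) simp

lemma borel_of_subset: "B \<in> sets (borel_of X) \<Longrightarrow> B \<subseteq> topspace X"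
  using sets.sets_into_space by fastforce

lemma borel_of_clopen: "A \<in> clopens X \<Longrightarrow> A \<in> sets (borel_of X)"
  unfolding clopens_def by (auto intro: borel_of_open)

lemma borel_measurable_continuous_map:
  assumes "continuous_map X euclideanreal f"
  shows "f \<in> borel_measurable (borel_of X)"
proof (rule borel_measurableI)
  fix S :: "real set" assume "open S"
  hence "openin X {x \<in> topspace X. f x \<in> S}"
    using openin_continuous_map_preimage[OF assms] by simp
  moreover have "f -` S \<inter> space (borel_of X) = {x \<in> topspace X. f x \<in> S}" by auto
  ultimately show "f -` S \<inter> space (borel_of X) \<in> sets (borel_of X)"
    using borel_of_open by simp
qed

section \<open>Variations and integrals of signed measures\<close>

lemma measure_of_measure_on_borel:
  assumes "finite_measure N" "sets N = sets (borel_of X)"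
    "\<And>B. B \<in> sets (borel_of X) \<Longrightarrow> v B = measure N B"
  shows "measure_of (topspace X) (sets (borel_of X)) (\<lambda>B. ennreal (v B)) = N"
proof -
  interpret finite_measure N by fact
  have sp: "space N = topspace X" using sets_eq_imp_space_eq[OF assms(2)] by simp
  have "measure_of (topspace X) (sets (borel_of X)) (\<lambda>B. ennreal (v B))
      = measure_of (topspace X) (sets (borel_of X)) (emeasure N)"
  proof (rule measure_of_eq)
    show "sets (borel_of X) \<subseteq> Pow (topspace X)" using borel_of_subset by blast
    fix B assume "B \<in> sigma_sets (topspace X) (sets (borel_of X))"
    hence "B \<in> sets (borel_of X)" using sets.sigma_sets_eq[of "borel_of X"] by simp
    thus "ennreal (v B) = emeasure N B" using assms(3) by (simp add: emeasure_eq_measure)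
  qed
  also have "\<dots> = N" using measure_of_of_measure[of N] sp assms(2) by simp
  finally show ?thesis .
qed

text \<open>If two finite measures live on complementary sets \<open>P\<close> and its complement, the suprema that
  define the positive and the negative variation of their difference are attained, at \<open>B \<inter> P\<close> and
  \<open>B - P\<close>. All measures below come with such a decomposition.\<close>

lemma jordan_decomposition:
  assumes N1: "finite_measure N1" "sets N1 = sets (borel_of X)"
    and N2: "finite_measure N2" "sets N2 = sets (borel_of X)"
    and P: "P \<in> sets (borel_of X)" "measure N1 (topspace X - P) = 0" "measure N2 P = 0"
    and v_eq: "\<forall>B \<in> sets (borel_of X). v B = measure N1 B - measure N2 B"
  shows "B \<in> sets (borel_of X) \<Longrightarrow> pos_var X v B = measure N1 B"
    and "B \<in> sets (borel_of X) \<Longrightarrow> neg_var X v B = measure N2 B"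
    and "signed_measure X v"
    and "signed_integral X v f = integral\<^sup>L N1 f - integral\<^sup>L N2 f"
proof -
  note v = v_eq[rule_format]
  interpret N1: finite_measure N1 by fact
  interpret N2: finite_measure N2 by fact
  have sub0: "measure N C = 0"
    if "finite_measure N" "C \<in> sets N" "D \<in> sets N" "C \<subseteq> D" "measure N D = 0" for N C D
    using finite_measure.finite_measure_mono[OF that(1,4,3)] that(5) by (simp add: measure_le_0_iff)
  have n1: "measure N1 (B - P) = 0" if "B \<in> sets (borel_of X)" for B
    using that P N1 borel_of_subset[OF that] by (intro sub0[OF N1(1) _ _ _ P(2)]) auto
  have n2: "measure N2 (B \<inter> P) = 0" if "B \<in> sets (borel_of X)" for B
    using that P N2 by (intro sub0[OF N2(1) _ _ _ P(3)]) auto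
  have eq1: "measure N1 B = measure N1 (B \<inter> P)" if B: "B \<in> sets (borel_of X)" for B
    using N1.finite_measure_Union[of "B \<inter> P" "B - P"] n1[OF B] B P N1(2)
    by (simp add: Int_Diff_disjoint Int_Diff_Un)
  have eq2: "measure N2 B = measure N2 (B - P)" if B: "B \<in> sets (borel_of X)" for B
    using N2.finite_measure_Union[of "B \<inter> P" "B - P"] n2[OF B] B P N2(2)
    by (simp add: Int_Diff_disjoint Int_Diff_Un)
  show pv: "pos_var X v B = measure N1 B" if B: "B \<in> sets (borel_of X)" for B
    unfolding pos_var_def
  proof (rule cSup_eq_maximum)
    have "v (B \<inter> P) = measure N1 B" using v[of "B \<inter> P"] eq1[OF B] n2[OF B] B P by simp
    moreover have "B \<inter> P \<in> {C \<in> sets (borel_of X). C \<subseteq> B}" using B P by auto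
    ultimately show "measure N1 B \<in> v ` {C \<in> sets (borel_of X). C \<subseteq> B}" by (metis imageI)
    fix x assume "x \<in> v ` {C \<in> sets (borel_of X). C \<subseteq> B}"
    then obtain C where C: "C \<in> sets (borel_of X)" "C \<subseteq> B" "x = v C" by auto
    have "measure N1 C \<le> measure N1 B" using N1.finite_measure_mono[of C B] C B N1(2) by simp
    thus "x \<le> measure N1 B" using v[OF C(1)] C(3) measure_nonneg[of N2 C] by linarith
  qed
  show nv: "neg_var X v B = measure N2 B" if B: "B \<in> sets (borel_of X)" for B
    unfolding neg_var_def
  proof (rule cSup_eq_maximum)
    have "measure N1 (B - P) = 0" using n1[OF B] .
    hence "- v (B - P) = measure N2 B" using v[of "B - P"] eq2[OF B] B P by simp
    moreover have "B - P \<in> {C \<in> sets (borel_of X). C \<subseteq> B}" using B P by auto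
    ultimately show "measure N2 B \<in> (\<lambda>C. - v C) ` {C \<in> sets (borel_of X). C \<subseteq> B}"
      by (metis (mono_tags, lifting) imageI)
    fix x assume "x \<in> (\<lambda>C. - v C) ` {C \<in> sets (borel_of X). C \<subseteq> B}"
    then obtain C where C: "C \<in> sets (borel_of X)" "C \<subseteq> B" "x = - v C" by auto
    have "measure N2 C \<le> measure N2 B" using N2.finite_measure_mono[of C B] C B N2(2) by simp
    thus "x \<le> measure N2 B" using v[OF C(1)] C(3) measure_nonneg[of N1 C] by linarith
  qed
  show "signed_measure X v"
    unfolding signed_measure_def
  proof (intro conjI allI impI)
    show "v {} = 0" using v[of "{}"] by simp
    fix A :: "nat \<Rightarrow> 'a set" assume A: "range A \<subseteq> sets (borel_of X)" "disjoint_family A"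
    have "(\<lambda>n. measure N1 (A n) - measure N2 (A n)) sums
            (measure N1 (\<Union>n. A n) - measure N2 (\<Union>n. A n))"
      using A N1(2) N2(2)
      by (intro sums_diff N1.finite_measure_UNION N2.finite_measure_UNION) auto
    moreover have "(\<Union>n. A n) \<in> sets (borel_of X)" using A by (intro sets.countable_UN) auto
    ultimately show "(\<lambda>n. v (A n)) sums v (\<Union>n. A n)" using A v by (simp add: image_subset_iff)
  qed
  show "signed_integral X v f = integral\<^sup>L N1 f - integral\<^sup>L N2 f"
    unfolding signed_integral_def
    using measure_of_measure_on_borel[OF N1 pv] measure_of_measure_on_borel[OF N2 nv] by simp
qed

lemma jordan_decomposition_nonneg:
  assumes N: "finite_measure N" "sets N = sets (borel_of X)"
  shows "B \<in> sets (borel_of X) \<Longrightarrow> total_var X (measure N) B = measure N B"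
    and "signed_measure X (measure N)"
    and "signed_integral X (measure N) f = integral\<^sup>L N f"
proof -
  let ?Z = "null_measure (borel_of X)"
  have Z: "finite_measure ?Z" by (rule finite_measureI) simp
  have sp: "space N = topspace X" using sets_eq_imp_space_eq[OF N(2)] by simp
  have P: "topspace X \<in> sets (borel_of X)" by (rule borel_of_open) simp
  note J = jordan_decomposition[OF N Z _ P, of "measure N"]
  show "B \<in> sets (borel_of X) \<Longrightarrow> total_var X (measure N) B = measure N B"
    unfolding total_var_def using J(1,2)[of B] by (simp add: measure_def)
  show "signed_measure X (measure N)" by (rule J(3)) (simp_all add: measure_def)
  have "integral\<^sup>L ?Z f = 0"
    by (intro integral_eq_zero_AE AE_I[of _ _ "topspace X"]) auto
  thus "signed_integral X (measure N) f = integral\<^sup>L N f"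
    using J(4)[of f] by (simp add: measure_def)
qed

section \<open>Measures with countable support\<close>

definition atomic :: "'a topology \<Rightarrow> ('a \<Rightarrow> real) \<Rightarrow> 'a measure" where
  "atomic X a = distr (density (count_space (topspace X)) (\<lambda>x. ennreal (a x))) (borel_of X) (\<lambda>x. x)"

lemma
  assumes "ell1 a" "\<And>x. 0 \<le> a x"
  shows finite_measure_atomic: "finite_measure (atomic X a)"
    and sets_atomic: "sets (atomic X a) = sets (borel_of X)"
    and measure_atomic: "B \<in> sets (borel_of X) \<Longrightarrow> measure (atomic X a) B = infsum a B"
proof -
  have em: "emeasure (atomic X a) B = ennreal (infsum a B)" if B: "B \<in> sets (borel_of X)" for B
  proof -
    have sub: "B \<subseteq> topspace X" using borel_of_subset[OF B] .
    have "emeasure (atomic X a) B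
        = emeasure (density (count_space (topspace X)) (\<lambda>x. ennreal (a x))) (B \<inter> topspace X)"
      unfolding atomic_def using B by (subst emeasure_distr) auto
    also have "\<dots> = (\<integral>\<^sup>+x. ennreal (a x) * indicator B x \<partial>count_space (topspace X))"
      using sub by (subst emeasure_density) (auto simp: Int_absorb2)
    also have "\<dots> = (\<integral>\<^sup>+x. ennreal (a x) \<partial>count_space B)"
      using sub by (simp add: nn_integral_restrict_space[symmetric] restrict_count_space Int_absorb2)
    also have "\<dots> = ennreal (infsetsum a B)"
      using assms(2) iffD1[OF abs_summable_equivalent, of a B] ell1_abs_summable_on[OF assms(1), of B]
      by (intro nn_integral_conv_infsetsum) simp_all
    also have "infsetsum a B = infsum a B"
      using iffD1[OF abs_summable_equivalent, of a B] ell1_abs_summable_on[OF assms(1), of B]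
      by (intro infsetsum_infsum) simp
    finally show ?thesis .
  qed
  show s: "sets (atomic X a) = sets (borel_of X)" unfolding atomic_def by simp
  have "topspace X \<in> sets (borel_of X)" by (rule borel_of_open) simp
  thus "finite_measure (atomic X a)"
    using em sets_eq_imp_space_eq[OF s] by (intro finite_measureI) simp
  show "B \<in> sets (borel_of X) \<Longrightarrow> measure (atomic X a) B = infsum a B"
    using em[of B] assms(2) by (simp add: measure_def infsum_nonneg)
qed

text \<open>The positive and the negative part of \<open>a\<close> live on disjoint countable sets, and countable sets are
  Borel. Finite sets are compact, so concentration of the mass on a finite set gives inner
  regularity.\<close>

lemma
  assumes X: "Hausdorff_space X" and l1: "ell1 a"
    and S: "countable S" "S \<subseteq> topspace X" "\<And>x. x \<notin> S \<Longrightarrow> a x = 0"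
    and v: "\<And>B. B \<in> sets (borel_of X) \<Longrightarrow> v B = infsum a B"
  shows radon_measure_ell1: "radon_measure X v"
    and signed_integral_ell1_indicator:
      "A \<in> sets (borel_of X) \<Longrightarrow> signed_integral X v (indicator A) = infsum a A"
proof -
  let ?p = "\<lambda>x. max 0 (a x)" and ?n = "\<lambda>x. max 0 (- a x)"
  have pn: "ell1 ?p" "ell1 ?n"
    unfolding ell1_def using l1[unfolded ell1_def]
    by (auto intro!: summable_on_comparison_test[of "\<lambda>x. \<bar>a x\<bar>"])
  note N1 = finite_measure_atomic[OF pn(1), of X, simplified] sets_atomic[OF pn(1), of X, simplified]
  note N2 = finite_measure_atomic[OF pn(2), of X, simplified] sets_atomic[OF pn(2), of X, simplified]
  note m1 = measure_atomic[OF pn(1), of _ X, simplified]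
  note m2 = measure_atomic[OF pn(2), of _ X, simplified]
  have countable_borel: "C \<in> sets (borel_of X)" if "countable C" "C \<subseteq> topspace X" for C
  proof (rule sets.countable[OF _ that(1)])
    fix x assume "x \<in> C"
    thus "{x} \<in> sets (borel_of X)"
      using that(2) X by (intro borel_of_closed closedin_Hausdorff_singleton) auto
  qed
  define P where "P = {x \<in> S. 0 < a x}"
  have P: "P \<in> sets (borel_of X)"
    unfolding P_def using S by (intro countable_borel) (auto intro: countable_subset)
  have P1: "measure (atomic X ?p) (topspace X - P) = 0"
  proof -
    have "a x \<le> 0" if "x \<notin> P" for x
      using that S(3)[of x] unfolding P_def by force
    thus ?thesis using P by (subst m1) (auto intro!: infsum_0 sets.Diff)
  qed
  have P2: "measure (atomic X ?n) P = 0"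
    using P by (subst m2) (auto intro!: infsum_0 simp: P_def)
  have "\<forall>B \<in> sets (borel_of X). v B = measure (atomic X ?p) B - measure (atomic X ?n) B"
  proof
    fix B assume B: "B \<in> sets (borel_of X)"
    have "measure (atomic X ?p) B - measure (atomic X ?n) B = (\<Sum>\<^sub>\<infinity>x\<in>B. ?p x - ?n x)"
      using m1[OF B] m2[OF B] infsum_ell1_diff[OF pn, of B] by simp
    also have "\<dots> = infsum a B" by (rule infsum_cong) auto
    finally show "v B = measure (atomic X ?p) B - measure (atomic X ?n) B" using v[OF B] by simp
  qed
  note J = jordan_decomposition[OF N1 N2 P P1 P2 this]
  have tv: "total_var X v B = mass a B" if B: "B \<in> sets (borel_of X)" for B
  proof -
    have "total_var X v B = (\<Sum>\<^sub>\<infinity>x\<in>B. ?p x) + (\<Sum>\<^sub>\<infinity>x\<in>B. ?n x)"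
      unfolding total_var_def using J(1,2)[OF B] m1[OF B] m2[OF B] by simp
    also have "\<dots> = (\<Sum>\<^sub>\<infinity>x\<in>B. ?p x + ?n x)"
      by (rule infsum_add[symmetric]) (auto intro: ell1_summable_on pn)
    also have "\<dots> = mass a B" unfolding mass_def by (rule infsum_cong) auto
    finally show ?thesis .
  qed
  show "radon_measure X v"
    unfolding radon_measure_def
  proof (intro conjI ballI allI impI J(3))
    fix B and e :: real assume B: "B \<in> sets (borel_of X)" and e: "0 < e"
    obtain V where V: "finite V" "mass a (- V) < e" using mass_concentrated[OF l1 e] .
    have sub: "B \<inter> V \<subseteq> topspace X" using borel_of_subset[OF B] by blast
    have "B \<inter> V \<in> sets (borel_of X)" using V sub by (intro countable_borel) (auto intro: countable_finite)
    moreover have "compactin X (B \<inter> V)" using V sub by (intro finite_imp_compactin) auto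
    moreover have "mass a (B - (B \<inter> V)) \<le> mass a (- V)" by (rule mass_mono[OF l1]) auto
    ultimately show "\<exists>C\<in>sets (borel_of X). compactin X C \<and> C \<subseteq> B \<and> total_var X v (B - C) < e"
      using V(2) B tv[of "B - (B \<inter> V)"] by (intro bexI[of _ "B \<inter> V"]) auto
  qed
  assume A: "A \<in> sets (borel_of X)"
  have "integral\<^sup>L N (indicator A) = measure N A" if "finite_measure N" "sets N = sets (borel_of X)"
    for N :: "'a measure"
    using A that borel_of_subset[OF A] sets_eq_imp_space_eq[OF that(2)]
    by (simp add: Int_absorb2)
  hence "signed_integral X v (indicator A) = measure (atomic X ?p) A - measure (atomic X ?n) A"
    using J(4)[of "indicator A"] N1 N2 by simp
  also have "\<dots> = (\<Sum>\<^sub>\<infinity>x\<in>A. ?p x - ?n x)"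
    using m1[OF A] m2[OF A] infsum_ell1_diff[OF pn, of A] by simp
  also have "\<dots> = infsum a A" by (rule infsum_cong) auto
  finally show "signed_integral X v (indicator A) = infsum a A" .
qed

lemma ell1_measure_density:
  assumes "ell1_measure X v"
  shows "\<exists>S a. countable S \<and> S \<subseteq> topspace X \<and> ell1 a \<and> (\<forall>x. x \<notin> S \<longrightarrow> a x = 0) \<and>
           (\<forall>B \<in> sets (borel_of X). v B = infsum a B)"
proof -
  obtain S \<alpha> where S: "countable S" "S \<subseteq> topspace X" "(\<lambda>x. \<bar>\<alpha> x\<bar>) summable_on S"
    "\<And>B. B \<in> sets (borel_of X) \<Longrightarrow> v B = (\<Sum>\<^sub>\<infinity>x\<in>S. \<alpha> x * indicator B x)"
    using assms unfolding ell1_measure_def by blast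
  define a where "a x = (if x \<in> S then \<alpha> x else 0)" for x
  have "(\<lambda>x. \<bar>a x\<bar>) summable_on UNIV \<longleftrightarrow> (\<lambda>x. \<bar>\<alpha> x\<bar>) summable_on S"
    by (rule summable_on_cong_neutral) (auto simp: a_def)
  hence "ell1 a" using S(3) unfolding ell1_def by simp
  moreover have "v B = infsum a B" if "B \<in> sets (borel_of X)" for B
    unfolding S(4)[OF that] by (rule infsum_cong_neutral) (auto simp: a_def)
  ultimately show ?thesis using S(1,2) by (intro exI[of _ S] exI[of _ a]) (auto simp: a_def)
qed

lemma continuous_map_indicator_clopen:
  assumes "A \<in> clopens X"
  shows "continuous_map X euclideanreal (indicator A)"
  unfolding continuous_map_def
proof (intro conjI allI impI)
  fix U :: "real set" assume "openin euclideanreal U"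
  have "{x \<in> topspace X. indicator A x \<in> U}
      = (if 1 \<in> U then A else {}) \<union> (if 0 \<in> U then topspace X - A else {})"
    using assms by (auto simp: clopens_def indicator_def dest: openin_subset)
  thus "openin X {x \<in> topspace X. indicator A x \<in> U}"
    using assms by (auto simp: clopens_def)
qed auto

text \<open>The given weak* limit serves only to know that the sequence converges on every clopen set. By the
  previous sections the sequence then converges in the norm of \<open>\<ell>\<^sub>1\<close>, and the norm limit is a Radon
  measure and a limit on every Borel set.\<close>

theorem interpolating_clopens_ell1_grothendieck:
  assumes sep: "clopen_separated X" and int: "interpolating (clopens X)"
  shows "ell1_grothendieck_property X"
  unfolding ell1_grothendieck_property_def
proof (intro allI impI)
  fix v :: "nat \<Rightarrow> 'a set \<Rightarrow> real"
  assume v: "\<forall>n. radon_measure X (v n) \<and> ell1_measure X (v n)"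
    and "\<exists>\<mu>. radon_measure X \<mu> \<and> weakstar_converges X v \<mu>"
  then obtain \<mu> where \<mu>: "weakstar_converges X v \<mu>" by blast
  interpret point_separating_algebra "topspace X" "clopens X"
    by (rule clopen_separated_algebra[OF sep])
  note X = clopen_separated_Hausdorff[OF sep]
  have "\<forall>n. \<exists>S a. countable S \<and> S \<subseteq> topspace X \<and> ell1 a \<and> (\<forall>x. x \<notin> S \<longrightarrow> a x = 0) \<and>
           (\<forall>B \<in> sets (borel_of X). v n B = infsum a B)"
    using v ell1_measure_density by blast
  then obtain T b where T: "\<And>n. countable (T n)" "\<And>n. T n \<subseteq> topspace X"
    "\<And>n x. x \<notin> T n \<Longrightarrow> b n x = 0" and b: "\<And>n. ell1 (b n)"
    "\<And>n B. B \<in> sets (borel_of X) \<Longrightarrow> v n B = infsum (b n) B" by metis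
  define S where "S = (\<Union>n. T n)"
  have S: "countable S" "S \<subseteq> topspace X" "\<And>n x. x \<notin> S \<Longrightarrow> b n x = 0"
    unfolding S_def using T by auto
  have conv: "convergent (\<lambda>n. infsum (b n) A)" if A: "A \<in> clopens X" for A
  proof -
    have "(\<lambda>n. signed_integral X (v n) (indicator A)) \<longlonglongrightarrow> signed_integral X \<mu> (indicator A)"
      using \<mu> continuous_map_indicator_clopen[OF A] unfolding weakstar_converges_def by blast
    moreover have "signed_integral X (v n) (indicator A) = infsum (b n) A" for n
      by (rule signed_integral_ell1_indicator[OF X b(1) S b(2) borel_of_clopen[OF A]])
    ultimately show ?thesis unfolding convergent_def by auto
  qed
  have cauchy: "\<exists>N. \<forall>m\<ge>N. \<forall>n\<ge>N. mass (\<lambda>x. b m x - b n x) UNIV < e" if "0 < e" for e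
    by (rule interpolating_ell1_Cauchy[OF b(1) int S conv that])
  obtain c where c: "ell1 c" "\<And>x. (\<lambda>n. b n x) \<longlonglongrightarrow> c x"
    "\<And>A. (\<lambda>n. infsum (b n) A) \<longlonglongrightarrow> infsum c A"
    using ell1_complete[of b, OF b(1)] cauchy by meson
  have "c x = 0" if "x \<notin> S" for x
    using c(2)[of x] S(3)[OF that] by (simp add: LIMSEQ_const_iff)
  hence "radon_measure X (infsum c)"
    by (intro radon_measure_ell1[OF X c(1) S(1,2)]) auto
  moreover have "weak_converges X v (infsum c)"
    unfolding weak_converges_def using c(3) b(2) by simp
  ultimately show "\<exists>\<mu>. radon_measure X \<mu> \<and> weak_converges X v \<mu>" by blast
qed

section \<open>From a content on the clopen sets to a Radon measure\<close>

lemma clopens_subset: "A \<in> clopens X \<Longrightarrow> A \<subseteq> topspace X"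
  unfolding clopens_def using openin_subset by blast

lemma clopens_Un: "A \<in> clopens X \<Longrightarrow> B \<in> clopens X \<Longrightarrow> A \<union> B \<in> clopens X"
  and clopens_Int: "A \<in> clopens X \<Longrightarrow> B \<in> clopens X \<Longrightarrow> A \<inter> B \<in> clopens X"
  and clopens_Diff: "A \<in> clopens X \<Longrightarrow> B \<in> clopens X \<Longrightarrow> A - B \<in> clopens X"
  and clopens_empty: "{} \<in> clopens X"
  and clopens_topspace: "topspace X \<in> clopens X"
  by (auto simp: clopens_def)

lemma clopens_finite_Union: "finite F \<Longrightarrow> F \<subseteq> clopens X \<Longrightarrow> \<Union>F \<in> clopens X"
  by (induction F rule: finite_induct) (auto intro: clopens_Un clopens_empty)

lemma compactin_clopen_between:
  assumes comp: "compact_space X" and sep: "clopen_separated X"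
    and C: "compactin X C" "C \<subseteq> U" and U: "openin X U"
  shows "\<exists>H\<in>clopens X. C \<subseteq> H \<and> H \<subseteq> U"
proof -
  have base: "\<exists>G\<in>clopens X. x \<in> G \<and> G \<subseteq> U" if x: "x \<in> U" for x
  proof -
    let ?D = "topspace X - U"
    have xX: "x \<in> topspace X" using x openin_subset[OF U] by blast
    have D: "compactin X ?D" using closedin_compact_space[OF comp] U by blast
    have "?D \<subseteq> \<Union>{G \<in> clopens X. x \<notin> G}"
    proof
      fix y assume "y \<in> ?D"
      then obtain A where "A \<in> clopens X" "y \<in> A" "x \<notin> A"
        using sep x xX unfolding clopen_separated_def by (metis DiffE)
      thus "y \<in> \<Union>{G \<in> clopens X. x \<notin> G}" by blast
    qed
    then obtain F where F: "finite F" "F \<subseteq> {G \<in> clopens X. x \<notin> G}" "?D \<subseteq> \<Union>F"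
      using compactinD[OF D, of "{G \<in> clopens X. x \<notin> G}"] by (auto simp: clopens_def)
    have "topspace X - \<Union>F \<in> clopens X"
      using F by (intro clopens_Diff clopens_topspace clopens_finite_Union) auto
    thus ?thesis using F xX by (intro bexI[of _ "topspace X - \<Union>F"]) auto
  qed
  have "C \<subseteq> \<Union>{G \<in> clopens X. G \<subseteq> U}" using base C(2) by blast
  then obtain F where F: "finite F" "F \<subseteq> {G \<in> clopens X. G \<subseteq> U}" "C \<subseteq> \<Union>F"
    using compactinD[OF C(1), of "{G \<in> clopens X. G \<subseteq> U}"] by (auto simp: clopens_def)
  have "\<Union>F \<in> clopens X" using F by (intro clopens_finite_Union) auto
  thus ?thesis using F by (intro bexI[of _ "\<Union>F"]) auto
qed

text \<open>Since clopen sets are compact, a finitely additive \<open>m\<close> on them is automatically countably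
  additive. But the outer measure made from countable covers by clopen sets need not measure all open
  sets. Hence \<open>m\<close> is extended to open sets from inside and then to all sets from outside.\<close>

locale clopen_content =
  fixes X :: "'a topology" and m :: "'a set \<Rightarrow> real"
  assumes comp: "compact_space X" and sep: "clopen_separated X"
    and nonneg: "A \<in> clopens X \<Longrightarrow> 0 \<le> m A"
    and additive: "A \<in> clopens X \<Longrightarrow> B \<in> clopens X \<Longrightarrow> A \<inter> B = {} \<Longrightarrow> m (A \<union> B) = m A + m B"
begin

definition inner_content :: "'a set \<Rightarrow> ennreal" where
  "inner_content U = (SUP A\<in>{A \<in> clopens X. A \<subseteq> U}. ennreal (m A))"

definition outer_content :: "'a set \<Rightarrow> ennreal" where
  "outer_content E = (INF U\<in>{U. openin X U \<and> E \<subseteq> U}. inner_content U)"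

lemma content_mono:
  assumes "A \<in> clopens X" "B \<in> clopens X" "A \<subseteq> B"
  shows "m A \<le> m B"
proof -
  have "A \<union> (B - A) = B" using assms by blast
  thus ?thesis
    using additive[of A "B - A"] nonneg[of "B - A"] assms clopens_Diff[of B X A] by auto
qed

lemma content_empty: "m {} = 0"
  using additive[of "{}" "{}"] clopens_empty[of X] by simp

lemma le_inner_content: "A \<in> clopens X \<Longrightarrow> A \<subseteq> U \<Longrightarrow> ennreal (m A) \<le> inner_content U"
  unfolding inner_content_def by (rule SUP_upper) simp

lemma inner_content_clopen: "A \<in> clopens X \<Longrightarrow> inner_content A = ennreal (m A)"
  by (intro antisym le_inner_content) (auto simp: inner_content_def intro!: SUP_least ennreal_leI content_mono)

lemma inner_content_mono: "U \<subseteq> V \<Longrightarrow> inner_content U \<le> inner_content V"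
  unfolding inner_content_def by (rule SUP_subset_mono) auto

text \<open>A clopen part \<open>A\<close> of \<open>U \<union> V\<close> splits: the compact set \<open>A - V\<close> lies in \<open>U\<close>, so a clopen set inside
  \<open>U\<close> cuts \<open>A\<close> into a part inside \<open>U\<close> and a part inside \<open>V\<close>.\<close>

lemma inner_content_Un:
  assumes "openin X U" "openin X V"
  shows "inner_content (U \<union> V) \<le> inner_content U + inner_content V"
  unfolding inner_content_def[of "U \<union> V"]
proof (rule SUP_least)
  fix A assume "A \<in> {A \<in> clopens X. A \<subseteq> U \<union> V}"
  hence A: "A \<in> clopens X" "A \<subseteq> U \<union> V" by auto
  have "compactin X (A - V)"
    using A assms by (intro closedin_compact_space[OF comp]) (auto simp: clopens_def)
  then obtain H where H: "H \<in> clopens X" "A - V \<subseteq> H" "H \<subseteq> U"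
    using compactin_clopen_between[OF comp sep, of "A - V" U] A assms by auto
  have AH: "A \<inter> H \<in> clopens X" "A - H \<in> clopens X" using A H by (auto intro: clopens_Int clopens_Diff)
  have "m A = m (A \<inter> H) + m (A - H)"
    using additive[OF AH] by (simp add: Int_Diff_disjoint Int_Diff_Un)
  hence "ennreal (m A) = ennreal (m (A \<inter> H)) + ennreal (m (A - H))"
    using nonneg AH by (simp add: ennreal_plus)
  also have "\<dots> \<le> inner_content U + inner_content V"
    using A H AH by (intro add_mono le_inner_content) auto
  finally show "ennreal (m A) \<le> inner_content U + inner_content V" .
qed

lemma inner_content_UN:
  assumes U: "\<And>i::nat. openin X (U i)"
  shows "inner_content (\<Union>i. U i) \<le> (\<Sum>i. inner_content (U i))"
proof -
  have fin: "inner_content (\<Union>i\<in>F. U i) \<le> (\<Sum>i\<in>F. inner_content (U i))" if "finite F" for F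
    using that
  proof (induction F rule: finite_induct)
    case empty
    thus ?case using inner_content_clopen[OF clopens_empty] content_empty by simp
  next
    case (insert i F)
    have "inner_content (U i \<union> (\<Union>i\<in>F. U i)) \<le> inner_content (U i) + inner_content (\<Union>i\<in>F. U i)"
      using U by (intro inner_content_Un) auto
    also have "\<dots> \<le> inner_content (U i) + (\<Sum>i\<in>F. inner_content (U i))" using insert by (intro add_mono) auto
    finally show ?case using insert by simp
  qed
  show ?thesis
    unfolding inner_content_def[of "\<Union>i. U i"]
  proof (rule SUP_least)
    fix A assume "A \<in> {A \<in> clopens X. A \<subseteq> (\<Union>i. U i)}"
    hence A: "A \<in> clopens X" "A \<subseteq> (\<Union>i. U i)" by auto
    have "compactin X A" using A by (intro closedin_compact_space[OF comp]) (auto simp: clopens_def)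
    then obtain G where G: "finite G" "G \<subseteq> range U" "A \<subseteq> \<Union>G"
      using compactinD[of X A "range U"] A(2) U by blast
    then obtain F where F: "finite F" "G = U ` F" using finite_subset_image[OF G(1,2)] by blast
    have "ennreal (m A) \<le> inner_content (\<Union>i\<in>F. U i)" using A G F by (intro le_inner_content) auto
    also have "\<dots> \<le> (\<Sum>i\<in>F. inner_content (U i))" using fin F by blast
    also have "\<dots> \<le> (\<Sum>i. inner_content (U i))" by (rule sum_le_suminf[OF summableI F(1)]) simp
    finally show "ennreal (m A) \<le> (\<Sum>i. inner_content (U i))" .
  qed
qed

lemma outer_content_le: "openin X U \<Longrightarrow> E \<subseteq> U \<Longrightarrow> outer_content E \<le> inner_content U"
  unfolding outer_content_def by (rule INF_lower) simp

lemma outer_content_open: "openin X U \<Longrightarrow> outer_content U = inner_content U"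
  by (intro antisym outer_content_le) (auto simp: outer_content_def intro!: INF_greatest inner_content_mono)

lemma outer_content_mono: "E \<subseteq> E' \<Longrightarrow> outer_content E \<le> outer_content E'"
  unfolding outer_content_def by (rule INF_superset_mono) auto

lemma outer_content_finite: "E \<subseteq> topspace X \<Longrightarrow> outer_content E < \<infinity>"
  using outer_content_le[OF openin_topspace, of E] inner_content_clopen[OF clopens_topspace]
  by (simp add: le_less_trans)

lemma outer_content_approx:
  assumes "E \<subseteq> topspace X" "0 < e"
  shows "\<exists>U. openin X U \<and> E \<subseteq> U \<and> inner_content U < outer_content E + ennreal e"
proof -
  define c where "c = outer_content E + ennreal e"
  have "outer_content E < c"
    unfolding c_def using outer_content_finite[OF assms(1)] assms(2)
    by (cases "outer_content E") (auto simp: ennreal_plus[symmetric] ennreal_less_iff simp del: ennreal_plus)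
  then obtain U where "openin X U" "E \<subseteq> U" "inner_content U < c"
    unfolding outer_content_def INF_less_iff by auto
  thus ?thesis unfolding c_def by blast
qed

lemma outer_measure_space_outer_content: "outer_measure_space (Pow (topspace X)) outer_content"
  unfolding outer_measure_space_def
proof (intro conjI)
  have "outer_content {} = 0" using outer_content_open[of "{}"] inner_content_clopen[OF clopens_empty] content_empty by simp
  thus "positive (Pow (topspace X)) outer_content" by (simp add: positive_def)
  show "increasing (Pow (topspace X)) outer_content" by (auto simp: increasing_def intro: outer_content_mono)
  show "countably_subadditive (Pow (topspace X)) outer_content"
    unfolding countably_subadditive_def
  proof (intro allI impI)
    fix E :: "nat \<Rightarrow> 'a set" assume E: "range E \<subseteq> Pow (topspace X)"
    show "outer_content (\<Union>i. E i) \<le> (\<Sum>i. outer_content (E i))"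
    proof (rule ennreal_le_epsilon)
      fix e :: real assume e: "0 < e"
      have "\<exists>U. openin X U \<and> E i \<subseteq> U \<and> inner_content U < outer_content (E i) + ennreal (e * (1/2)^Suc i)" for i
        using E e by (intro outer_content_approx) auto
      then obtain U where U: "\<And>i. openin X (U i)" "\<And>i. E i \<subseteq> U i"
        "\<And>i. inner_content (U i) < outer_content (E i) + ennreal (e * (1/2)^Suc i)" by metis
      have "outer_content (\<Union>i. E i) \<le> inner_content (\<Union>i. U i)" using U by (intro outer_content_le) auto
      also have "\<dots> \<le> (\<Sum>i. inner_content (U i))" by (rule inner_content_UN[OF U(1)])
      also have "\<dots> \<le> (\<Sum>i. outer_content (E i) + ennreal (e * (1/2)^Suc i))"
        using U(3) by (intro suminf_le) (auto intro: less_imp_le)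
      also have "\<dots> = (\<Sum>i. outer_content (E i)) + (\<Sum>i. ennreal (e * (1/2)^Suc i))"
        by (rule suminf_add[symmetric]) auto
      also have "(\<Sum>i. ennreal (e * (1/2)^Suc i)) = ennreal e"
        using e sums_mult[OF power_half_series, of e] by (intro suminf_ennreal_eq) auto
      finally show "outer_content (\<Union>i. E i) \<le> (\<Sum>i. outer_content (E i)) + ennreal e" .
    qed
  qed
qed

text \<open>This is the Caratheodory condition for the open set \<open>U\<close>, tested on open sets: exhaust \<open>G \<inter> U\<close>
  by a clopen \<open>A\<close>, and then the open set \<open>G - A\<close>, which contains \<open>G - U\<close>, by a clopen \<open>B\<close>.\<close>

lemma inner_content_split:
  assumes G: "openin X G" and U: "openin X U"
  shows "outer_content (G \<inter> U) + outer_content (G - U) \<le> inner_content G"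
proof -
  have "outer_content (G \<inter> U) + outer_content (G - U) = inner_content (G \<inter> U) + outer_content (G - U)"
    using G U by (subst outer_content_open) auto
  also have "\<dots> = (SUP A\<in>{A \<in> clopens X. A \<subseteq> G \<inter> U}. ennreal (m A) + outer_content (G - U))"
    unfolding inner_content_def using clopens_empty[of X]
    by (intro ennreal_SUP_add_left[symmetric]) auto
  also have "\<dots> \<le> inner_content G"
  proof (rule SUP_least)
    fix A assume "A \<in> {A \<in> clopens X. A \<subseteq> G \<inter> U}"
    hence A: "A \<in> clopens X" "A \<subseteq> G \<inter> U" by auto
    have "outer_content (G - U) \<le> inner_content (G - A)"
      using A G by (intro outer_content_le) (auto simp: clopens_def)
    hence "ennreal (m A) + outer_content (G - U) \<le> ennreal (m A) + inner_content (G - A)" by (intro add_mono) auto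
    also have "\<dots> = (SUP B\<in>{B \<in> clopens X. B \<subseteq> G - A}. ennreal (m A) + ennreal (m B))"
      unfolding inner_content_def using clopens_empty[of X] by (subst ennreal_SUP_add_right[symmetric]) auto
    also have "\<dots> \<le> inner_content G"
    proof (rule SUP_least)
      fix B assume "B \<in> {B \<in> clopens X. B \<subseteq> G - A}"
      hence B: "B \<in> clopens X" "B \<subseteq> G - A" by auto
      have "A \<inter> B = {}" using B by blast
      hence "ennreal (m A) + ennreal (m B) = ennreal (m (A \<union> B))"
        using additive[OF A(1) B(1)] A B nonneg by (simp add: ennreal_plus)
      also have "\<dots> \<le> inner_content G" using A B by (intro le_inner_content clopens_Un) auto
      finally show "ennreal (m A) + ennreal (m B) \<le> inner_content G" .
    qed
    finally show "ennreal (m A) + outer_content (G - U) \<le> inner_content G" .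
  qed
  finally show ?thesis .
qed

lemma open_in_lambda_system:
  assumes U: "openin X U"
  shows "U \<in> lambda_system (topspace X) (Pow (topspace X)) outer_content"
  unfolding lambda_system_def
proof (intro CollectI conjI ballI)
  show "U \<in> Pow (topspace X)" using openin_subset[OF U] by blast
  fix E assume "E \<in> Pow (topspace X)"
  hence E: "E \<subseteq> topspace X" by blast
  have "outer_content E \<le> outer_content ((U \<inter> E) \<union> ((topspace X - U) \<inter> E))" using E by (intro outer_content_mono) auto
  also have "\<dots> \<le> outer_content (U \<inter> E) + outer_content ((topspace X - U) \<inter> E)"
  proof -
    have "subadditive (Pow (topspace X)) outer_content"
      using outer_measure_space_outer_content unfolding outer_measure_space_def
      by (intro ring_of_sets.countably_subadditive_subadditive[OF ring_of_sets_Pow]) auto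
    thus ?thesis using E by (intro subadditiveD) auto
  qed
  finally have 1: "outer_content E \<le> outer_content (U \<inter> E) + outer_content ((topspace X - U) \<inter> E)" .
  have 2: "outer_content (U \<inter> E) + outer_content ((topspace X - U) \<inter> E) \<le> outer_content E"
    unfolding outer_content_def[of E]
  proof (rule INF_greatest)
    fix G assume "G \<in> {G. openin X G \<and> E \<subseteq> G}"
    hence G: "openin X G" "E \<subseteq> G" by auto
    have "outer_content (U \<inter> E) + outer_content ((topspace X - U) \<inter> E) \<le> outer_content (G \<inter> U) + outer_content (G - U)"
      using G by (intro add_mono outer_content_mono) auto
    also have "\<dots> \<le> inner_content G" using inner_content_split[OF G(1) U] .
    finally show "outer_content (U \<inter> E) + outer_content ((topspace X - U) \<inter> E) \<le> inner_content G" .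
  qed
  show "outer_content (U \<inter> E) + outer_content ((topspace X - U) \<inter> E) = outer_content E" using 1 2 by (rule antisym[rotated])
qed

text \<open>Outer approximation of a complement by an open set is inner approximation by a closed, hence
  compact, set.\<close>

theorem content_extends_to_radon_measure:
  obtains N where "finite_measure N" "sets N = sets (borel_of X)" "radon_measure X (measure N)"
    "\<And>A. A \<in> clopens X \<Longrightarrow> measure N A = m A"
proof -
  let ?L = "lambda_system (topspace X) (Pow (topspace X)) outer_content"
  let ?N = "measure_of (topspace X) {U. openin X U} outer_content"
  interpret P: sigma_algebra "topspace X" "Pow (topspace X)" by (rule sigma_algebra_Pow)
  have L: "measure_space (topspace X) ?L outer_content"
    using P.caratheodory_lemma[OF outer_measure_space_outer_content] .
  have sub: "sigma_sets (topspace X) {U. openin X U} \<subseteq> ?L"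
    using L open_in_lambda_system unfolding measure_space_def
    by (intro sigma_algebra.sigma_sets_subset) auto
  have opens: "{U. openin X U} \<subseteq> Pow (topspace X)" by (auto dest: openin_subset)
  have s: "sets ?N = sets (borel_of X)" using opens by (simp add: sets_borel_of)
  have em: "emeasure ?N B = outer_content B" if "B \<in> sets (borel_of X)" for B
  proof (rule emeasure_measure_of[OF refl opens])
    show "B \<in> sets ?N" using that s by simp
    show "positive (sets ?N) outer_content" using L unfolding measure_space_def positive_def by blast
    have "sets ?N \<subseteq> ?L" using sub s by (simp add: sets_borel_of)
    thus "countably_additive (sets ?N) outer_content"
      using L unfolding measure_space_def countably_additive_def by (meson subset_iff)
  qed
  have sp: "space ?N = topspace X" using opens by simp
  have fin: "finite_measure ?N"
    using outer_content_finite[of "topspace X"] em[of "topspace X"] sp by (intro finite_measureI) auto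
  have clop: "measure ?N A = m A" if A: "A \<in> clopens X" for A
    using em[OF borel_of_clopen[OF A]] outer_content_open[of A] inner_content_clopen[OF A] nonneg[OF A] A
    by (simp add: measure_def clopens_def)
  interpret N: finite_measure ?N by (rule fin)
  note JN = jordan_decomposition_nonneg[OF fin s]
  have "radon_measure X (measure ?N)"
    unfolding radon_measure_def
  proof (intro conjI ballI allI impI JN(2))
    fix B and e :: real assume B: "B \<in> sets (borel_of X)" and e: "0 < e"
    let ?B = "topspace X - B"
    have cB: "?B \<in> sets (borel_of X)" using B by (intro sets.Diff) auto
    obtain U where U: "openin X U" "?B \<subseteq> U" "inner_content U < outer_content ?B + ennreal e"
      using outer_content_approx[OF _ e, of ?B] by auto
    have "ennreal (measure ?N U) < ennreal (measure ?N ?B) + ennreal e"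
      using U em[OF borel_of_open[OF U(1)]] em[OF cB] outer_content_open[OF U(1)]
      by (simp add: N.emeasure_eq_measure)
    hence lt: "measure ?N U < measure ?N ?B + e"
      using e by (simp add: ennreal_plus[symmetric] ennreal_less_iff del: ennreal_plus)
    let ?C = "topspace X - U"
    have C: "closedin X ?C" using U by blast
    have "B - ?C = U - ?B" using U borel_of_subset[OF B] openin_subset[OF U(1)] by auto
    hence "measure ?N (B - ?C) = measure ?N U - measure ?N ?B"
      using U cB s borel_of_open[OF U(1)] by (simp add: N.finite_measure_Diff)
    hence "total_var X (measure ?N) (B - ?C) < e"
      using JN(1)[of "B - ?C"] B borel_of_closed[OF C] lt by simp
    thus "\<exists>C\<in>sets (borel_of X). compactin X C \<and> C \<subseteq> B \<and> total_var X (measure ?N) (B - C) < e"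
      using C U borel_of_closed[OF C] closedin_compact_space[OF comp C]
      by (intro bexI[of _ ?C]) auto
  qed
  thus thesis using that fin s clop by blast
qed

end

section \<open>A weak* convergent sequence of measures that is not weakly convergent\<close>

text \<open>The Radon extensions of the \<open>m k\<close> converge weak* to the Dirac measure at \<open>p\<close>, because a
  continuous function is nearly constant on a clopen neighbourhood of \<open>p\<close>, whose complement loses all
  its measure. A weak limit \<open>\<nu>\<close> would vanish on each \<open>U j\<close>, since \<open>p\<close> is not in \<open>U j\<close>, but not on
  their union, which has measure 1 for all the extensions; so \<open>\<nu>\<close> would not be countably additive.\<close>

lemma contents_to_point_not_grothendieck:
  assumes comp: "compact_space X" and sep: "clopen_separated X" and p: "p \<in> topspace X"
    and m: "\<And>k. clopen_content X (m k)" "\<And>k. m k (topspace X) = 1"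
    and lim: "\<And>A. A \<in> clopens X \<Longrightarrow> p \<notin> A \<Longrightarrow> (\<lambda>k. m k A) \<longlonglongrightarrow> 0"
    and U: "\<And>k::nat. U k \<in> clopens X" "disjoint_family U" "\<And>k. p \<notin> U k" "\<And>k. m k (U k) = 1"
  shows "\<not> grothendieck_property X"
proof
  assume groth: "grothendieck_property X"
  note X = clopen_separated_Hausdorff[OF sep]
  have "\<forall>k. \<exists>N. finite_measure N \<and> sets N = sets (borel_of X) \<and> radon_measure X (measure N) \<and>
          (\<forall>A\<in>clopens X. measure N A = m k A)"
    using clopen_content.content_extends_to_radon_measure[OF m(1)] by metis
  then obtain N where N: "\<And>k. finite_measure (N k)" "\<And>k. sets (N k) = sets (borel_of X)"
    "\<And>k. radon_measure X (measure (N k))" "\<And>k A. A \<in> clopens X \<Longrightarrow> measure (N k) A = m k A"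
    by metis
  have sp: "space (N k) = topspace X" for k using sets_eq_imp_space_eq[OF N(2)[of k]] by simp
  \<comment> \<open>the Dirac measure at \<open>p\<close>\<close>
  let ?D = "distr (count_space {()}) (borel_of X) (\<lambda>_. p)"
  have pm: "(\<lambda>_. p) \<in> count_space {()} \<rightarrow>\<^sub>M borel_of X" using p by simp
  have D: "finite_measure ?D" "sets ?D = sets (borel_of X)"
    by (auto intro: finite_measure.finite_measure_distr[OF finite_measure_count_space pm])
  have radonD: "radon_measure X (measure ?D)"
    unfolding radon_measure_def
  proof (intro conjI ballI allI impI jordan_decomposition_nonneg(2)[OF D])
    fix B and e :: real assume B: "B \<in> sets (borel_of X)" and e: "0 < e"
    let ?C = "B \<inter> {p}"
    have C: "closedin X ?C" using p X by (cases "p \<in> B") (auto simp: closedin_Hausdorff_singleton)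
    have BC: "B - ?C \<in> sets (borel_of X)" using B borel_of_closed[OF C] by blast
    have "total_var X (measure ?D) (B - ?C) = 0"
      using jordan_decomposition_nonneg(1)[OF D BC] BC by (simp add: measure_distr[OF pm])
    thus "\<exists>C\<in>sets (borel_of X). compactin X C \<and> C \<subseteq> B \<and> total_var X (measure ?D) (B - C) < e"
      using e borel_of_closed[OF C] closedin_compact_space[OF comp C] by (intro bexI[of _ ?C]) auto
  qed
  have ws: "weakstar_converges X (\<lambda>k. measure (N k)) (measure ?D)"
    unfolding weakstar_converges_def
  proof (intro allI impI)
    fix f assume f: "continuous_map X euclideanreal f"
    note fm = borel_measurable_continuous_map[OF f]
    have "compactin euclideanreal (f ` topspace X)"
      using comp f image_compactin unfolding compact_space_def by blast
    hence "bounded (f ` topspace X)" by (simp add: compact_imp_bounded)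
    then obtain b where b: "\<And>x. x \<in> topspace X \<Longrightarrow> \<bar>f x\<bar> \<le> b"
      unfolding bounded_iff by auto
    have b0: "0 \<le> b" using b[OF p] by linarith
    have fint: "integrable (N k) f" for k
    proof (rule finite_measure.integrable_const_bound[OF N(1), where B = b])
      show "AE x in N k. norm (f x) \<le> b" using b sp by (intro AE_I2) auto
      show "f \<in> borel_measurable (N k)" using fm by (simp add: measurable_cong_sets[OF N(2) refl])
    qed
    have "(\<lambda>k. integral\<^sup>L (N k) f) \<longlonglongrightarrow> f p"
    proof (rule LIMSEQ_I)
      fix e :: real assume e: "0 < e"
      let ?V = "{x \<in> topspace X. f x \<in> ball (f p) (e/2)}"
      have V: "openin X ?V" by (rule openin_continuous_map_preimage[OF f]) auto
      have "compactin X {p}" using p by simp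
      then obtain H where H: "H \<in> clopens X" "p \<in> H" "H \<subseteq> ?V"
        using compactin_clopen_between[OF comp sep _ _ V, of "{p}"] p e by auto
      let ?A = "topspace X - H"
      have A: "?A \<in> clopens X" using H by (intro clopens_Diff clopens_topspace)
      have "0 < e / (2 * (2 * b + 1))" using e b0 by simp
      then obtain k0 where k0: "\<And>k. k \<ge> k0 \<Longrightarrow> \<bar>m k ?A\<bar> < e / (2 * (2 * b + 1))"
        using LIMSEQ_D[OF lim[OF A]] H(2) by force
      have "\<bar>integral\<^sup>L (N k) f - f p\<bar> < e" if "k \<ge> k0" for k
      proof -
        interpret finite_measure "N k" by (rule N(1))
        have one: "measure (N k) (space (N k)) = 1" using N(4)[OF clopens_topspace] m(2) sp by simp
        have AN: "?A \<in> sets (N k)" using borel_of_clopen[OF A] N(2) by simp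
        have ind: "integrable (N k) (indicat_real ?A)"
          using AN by (simp add: integrable_indicator_iff emeasure_eq_measure)
        have "\<bar>integral\<^sup>L (N k) f - f p\<bar> = \<bar>integral\<^sup>L (N k) (\<lambda>x. f x - f p)\<bar>"
          using fint one by simp
        also have "\<dots> \<le> integral\<^sup>L (N k) (\<lambda>x. \<bar>f x - f p\<bar>)" by (rule integral_abs_bound)
        also have "\<dots> \<le> integral\<^sup>L (N k) (\<lambda>x. e/2 + (2 * b) * indicator ?A x)"
        proof (rule integral_mono)
          show "integrable (N k) (\<lambda>x. \<bar>f x - f p\<bar>)" using fint by auto
          show "integrable (N k) (\<lambda>x. e/2 + (2 * b) * indicator ?A x)" using ind by auto
          fix x assume "x \<in> space (N k)"
          hence x: "x \<in> topspace X" using sp by simp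
          show "\<bar>f x - f p\<bar> \<le> e/2 + (2 * b) * indicator ?A x"
          proof (cases "x \<in> H")
            case True
            hence "\<bar>f x - f p\<bar> < e/2" using H by (auto simp: dist_real_def abs_minus_commute)
            thus ?thesis using b0 by (simp add: indicator_def)
          next
            case False
            have "\<bar>f x - f p\<bar> \<le> 2 * b" using b[OF x] b[OF p] by linarith
            thus ?thesis using False x e by (simp add: indicator_def)
          qed
        qed
        also have "\<dots> = e/2 + 2 * b * m k ?A"
          using one AN ind N(4)[OF A, of k] sp by (simp add: Int_absorb2)
        also have "\<dots> < e"
        proof -
          have "2 * b * m k ?A \<le> 2 * b * \<bar>m k ?A\<bar>"
            using b0 by (intro mult_left_mono) auto
          also have "\<dots> \<le> (2 * b + 1) * \<bar>m k ?A\<bar>" by (intro mult_right_mono) auto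
          also have "\<dots> < e/2" using k0[OF that] b0 by (simp add: field_simps)
          finally show ?thesis by simp
        qed
        finally show ?thesis .
      qed
      thus "\<exists>k0. \<forall>k\<ge>k0. norm (integral\<^sup>L (N k) f - f p) < e" by auto
    qed
    moreover have "signed_integral X (measure ?D) f = f p"
      using jordan_decomposition_nonneg(3)[OF D, of f] integral_distr[OF pm fm]
      by (simp add: lebesgue_integral_count_space_finite)
    ultimately show "(\<lambda>k. signed_integral X (measure (N k)) f) \<longlonglongrightarrow> signed_integral X (measure ?D) f"
      using jordan_decomposition_nonneg(3)[OF N(1,2)] by simp
  qed
  have "\<exists>\<nu>. radon_measure X \<nu> \<and> weak_converges X (\<lambda>k. measure (N k)) \<nu>"
    using groth[unfolded grothendieck_property_def, rule_format, of "\<lambda>k. measure (N k)"]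
      N(3) conjI[OF radonD ws] by blast
  then obtain \<nu> where \<nu>: "radon_measure X \<nu>" "weak_converges X (\<lambda>k. measure (N k)) \<nu>" by blast
  have UB: "range U \<subseteq> sets (borel_of X)" using U(1) borel_of_clopen by blast
  have U0: "\<nu> (U j) = 0" for j
  proof -
    have "(\<lambda>k. measure (N k) (U j)) \<longlonglongrightarrow> \<nu> (U j)"
      using \<nu>(2) UB unfolding weak_converges_def by blast
    moreover have "(\<lambda>k. measure (N k) (U j)) \<longlonglongrightarrow> 0" using lim[OF U(1,3)] N(4)[OF U(1)] by simp
    ultimately show ?thesis by (rule LIMSEQ_unique)
  qed
  have "(\<lambda>n. \<nu> (U n)) sums \<nu> (\<Union>n. U n)"
    using \<nu>(1) UB U(2) unfolding radon_measure_def signed_measure_def by blast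
  hence 0: "\<nu> (\<Union>n. U n) = 0" using U0 by (simp add: sums_iff)
  have UU: "(\<Union>n. U n) \<in> sets (borel_of X)" using UB by (intro sets.countable_UN) auto
  have "(\<lambda>k. measure (N k) (\<Union>n. U n)) \<longlonglongrightarrow> \<nu> (\<Union>n. U n)"
    using \<nu>(2) UU unfolding weak_converges_def by blast
  moreover have "1 \<le> measure (N k) (\<Union>n. U n)" for k
    using finite_measure.finite_measure_mono[OF N(1), of "U k" "\<Union>n. U n" k] UU N(2)[of k]
      N(4)[OF U(1), of k k] U(4)[of k] by force
  ultimately have "1 \<le> \<nu> (\<Union>n. U n)" by (intro LIMSEQ_le_const) auto
  thus False using 0 by simp
qed

section \<open>A diffuse content on the natural numbers\<close>

lemma card_residue_class:
  fixes c q n :: nat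
  assumes "c < 2 ^ q" "q \<le> n"
  shows "card ({i. i mod 2 ^ q = c} \<inter> {..<2 ^ n}) = 2 ^ (n - q)"
proof -
  have n: "(2::nat) ^ n = 2 ^ (n - q) * 2 ^ q" using assms(2) by (simp flip: power_add)
  have "{i. i mod 2 ^ q = c} \<inter> {..<2 ^ n} = (\<lambda>j. j * 2 ^ q + c) ` {..<2 ^ (n - q)}"
  proof (intro equalityI subsetI)
    fix i assume i: "i \<in> {i. i mod 2 ^ q = c} \<inter> {..<2 ^ n}"
    hence "i div 2 ^ q < 2 ^ (n - q)" using n by (simp add: less_mult_imp_div_less)
    moreover have "i = i div 2 ^ q * 2 ^ q + c" using i div_mult_mod_eq[of i "2 ^ q"] by simp
    ultimately show "i \<in> (\<lambda>j. j * 2 ^ q + c) ` {..<2 ^ (n - q)}" by blast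
  next
    fix i assume "i \<in> (\<lambda>j. j * 2 ^ q + c) ` {..<2 ^ (n - q)}"
    then obtain j where j: "j < 2 ^ (n - q)" "i = j * 2 ^ q + c" by blast
    have "Suc j * 2 ^ q \<le> 2 ^ (n - q) * 2 ^ q" using j(1) by (intro mult_le_mono1) simp
    thus "i \<in> {i. i mod 2 ^ q = c} \<inter> {..<2 ^ n}" using j assms(1) n by simp
  qed
  moreover have "inj_on (\<lambda>j. j * 2 ^ q + c) {..<2 ^ (n - q)}" by (rule inj_onI) simp
  ultimately show ?thesis by (simp add: card_image)
qed

text \<open>A cluster point, in the compact space of functions from sets to \<open>{0..1}\<close>, of the densities of
  \<open>E\<close> in \<open>{..<2 ^ n}\<close>. The properties claimed are closed conditions that hold for the densities,
  those on residue classes exactly from \<open>n = q\<close> on.\<close>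

lemma diffuse_content_on_nat:
  obtains d :: "nat set \<Rightarrow> real" where
    "\<And>E. 0 \<le> d E" "d UNIV = 1" "\<And>E F. E \<inter> F = {} \<Longrightarrow> d (E \<union> F) = d E + d F"
    "\<And>q c. c < 2 ^ q \<Longrightarrow> d {i. i mod 2 ^ q = c} = 1 / 2 ^ q"
proof -
  define D :: "nat \<Rightarrow> nat set \<Rightarrow> real" where "D n E = card (E \<inter> {..<2 ^ n}) / 2 ^ n" for n E
  have "compactin (product_topology (\<lambda>i::nat set. euclideanreal) UNIV) (PiE UNIV (\<lambda>_. {0..1}))"
    by (subst compactin_PiE) auto
  hence comp: "compact (PiE UNIV (\<lambda>_::nat set. {0..1::real}))"
    by (simp add: euclidean_product_topology)
  have D01: "D n E \<in> {0..1}" for n E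
  proof -
    have "card (E \<inter> {..<2 ^ n}) \<le> card {..<2 ^ n :: nat}" by (rule card_mono) auto
    hence "real (card (E \<inter> {..<2 ^ n})) \<le> 2 ^ n" using of_nat_mono by fastforce
    thus ?thesis unfolding D_def by simp
  qed
  let ?F = "filtermap D sequentially"
  have "D n \<in> PiE UNIV (\<lambda>_. {0..1})" for n using D01 by (auto simp: PiE_iff)
  hence "\<forall>\<^sub>F f in ?F. f \<in> PiE UNIV (\<lambda>_. {0..1})" by (simp add: eventually_filtermap)
  then obtain d where d: "inf (nhds d) ?F \<noteq> bot"
    using comp[unfolded compact_filter, rule_format, of ?F] by (auto simp: filtermap_bot_iff)
  have lim: "P d" if "closed {f. P f}" "\<forall>\<^sub>F n in sequentially. P (D n)" for P
  proof (rule ccontr)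
    assume "\<not> P d"
    hence "\<forall>\<^sub>F f in nhds d. \<not> P f"
      using eventually_nhds_in_open[of "- {f. P f}" d] that(1) by (simp add: open_Compl)
    moreover have "\<forall>\<^sub>F f in ?F. P f" using that(2) by (simp add: eventually_filtermap)
    ultimately have "\<forall>\<^sub>F f in inf (nhds d) ?F. False"
      unfolding eventually_inf by (intro exI[of _ "\<lambda>f. \<not> P f"] exI[of _ P]) auto
    thus False using d by (simp add: eventually_False)
  qed
  show thesis
  proof (rule that[of d])
    show "0 \<le> d E" for E
      by (rule lim[of "\<lambda>f. 0 \<le> f E"]) (auto intro!: closed_Collect_le always_eventually simp: D_def)
    show "d UNIV = 1"
      by (rule lim[of "\<lambda>f. f UNIV = 1"]) (auto intro!: closed_Collect_eq always_eventually simp: D_def)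
    show "d (E \<union> F) = d E + d F" if "E \<inter> F = {}" for E F
    proof (rule lim[of "\<lambda>f. f (E \<union> F) = f E + f F"])
      have "card ((E \<union> F) \<inter> {..<2 ^ n}) = card (E \<inter> {..<2 ^ n}) + card (F \<inter> {..<2 ^ n})" for n :: nat
        using that by (subst card_Un_disjoint[symmetric]) (auto intro!: arg_cong[where f = card])
      thus "\<forall>\<^sub>F n in sequentially. D n (E \<union> F) = D n E + D n F"
        by (intro always_eventually allI) (simp add: D_def add_divide_distrib)
      show "closed {f :: nat set \<Rightarrow> real. f (E \<union> F) = f E + f F}"
        by (intro closed_Collect_eq continuous_on_add) auto
    qed
    show "d {i. i mod 2 ^ q = c} = 1 / 2 ^ q" if c: "c < 2 ^ q" for q c
    proof (rule lim[of "\<lambda>f. f {i. i mod 2 ^ q = c} = 1 / 2 ^ q"])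
      have "D n {i. i mod 2 ^ q = c} = 1 / 2 ^ q" if "q \<le> n" for n
      proof -
        have "(2::real) ^ n = 2 ^ (n - q) * 2 ^ q" using that by (simp flip: power_add)
        thus ?thesis unfolding D_def card_residue_class[OF c that] by simp
      qed
      thus "\<forall>\<^sub>F n in sequentially. D n {i. i mod 2 ^ q = c} = 1 / 2 ^ q"
        unfolding eventually_sequentially by blast
      show "closed {f :: nat set \<Rightarrow> real. f {i. i mod 2 ^ q = c} = 1 / 2 ^ q}"
        by (intro closed_Collect_eq) auto
    qed
  qed
qed

section \<open>An uncountable almost disjoint family\<close>

text \<open>The dyadic approximations from below of two different reals agree only finitely often.\<close>

lemma almost_disjoint_family:
  fixes N :: "nat set"
  assumes "infinite N"
  obtains M :: "real \<Rightarrow> nat set" where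
    "\<And>r. infinite (M r)" "\<And>r. M r \<subseteq> N" "\<And>r s. r \<noteq> s \<Longrightarrow> finite (M r \<inter> M s)"
proof -
  define g where "g r = (\<lambda>n::nat. to_nat (n, \<lfloor>r * 2 ^ n\<rfloor>))" for r :: real
  define h where "h = enumerate N"
  have h: "inj h" "range h = N"
    using bij_enumerate[OF assms] unfolding h_def bij_betw_def by auto
  have inf: "infinite (range (g r))" for r
    by (rule range_inj_infinite) (auto simp: g_def inj_def)
  have lt: "finite (range (g r) \<inter> range (g s))" if rs: "r < s" for r s
  proof -
    obtain n0 :: nat where n0: "1 / (s - r) < 2 ^ n0" using real_arch_pow[of 2 "1 / (s - r)"] by auto
    have "n < n0" if "\<lfloor>r * 2 ^ n\<rfloor> = \<lfloor>s * 2 ^ n\<rfloor>" for n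
    proof (rule ccontr)
      assume "\<not> n < n0"
      hence "(2::real) ^ n0 \<le> 2 ^ n" by (intro power_increasing) auto
      hence "1 / (s - r) < 2 ^ n" using n0 by linarith
      hence "1 < s * 2 ^ n - r * 2 ^ n" using rs by (simp add: field_simps)
      thus False using that by linarith
    qed
    hence "range (g r) \<inter> range (g s) \<subseteq> g r ` {..<n0}" by (auto simp: g_def)
    thus ?thesis by (rule finite_subset) simp
  qed
  have "finite (range (g r) \<inter> range (g s))" if "r \<noteq> s" for r s
    using lt[of r s] lt[of s r] that by (cases r s rule: linorder_cases) (auto simp: Int_commute)
  thus thesis
    using that[of "\<lambda>r. h ` range (g r)"] h inf
    by (auto simp: image_Int[symmetric] finite_image_iff inj_on_subset)
qed

section \<open>Extremally disconnected compact spaces\<close>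

locale extremally_disconnected_compact =
  fixes K :: "'a topology"
  assumes compact: "compact_space K" and Hausdorff: "Hausdorff_space K"
    and extremal: "extremally_disconnected_space K"
begin

lemma closure_clopen: "openin K U \<Longrightarrow> K closure_of U \<in> clopens K"
  using extremal unfolding extremally_disconnected_space_def clopens_def by simp

lemma closures_disjoint:
  assumes "openin K U" "openin K V" "U \<inter> V = {}"
  shows "K closure_of U \<inter> K closure_of V = {}"
proof -
  have "U \<inter> K closure_of V = {}" using openin_Int_closure_of_eq_empty[OF assms(1)] assms(3) by blast
  moreover have "openin K (K closure_of V)"
    using closure_clopen[OF assms(2)] by (simp add: clopens_def)
  ultimately show ?thesis
    using openin_Int_closure_of_eq_empty[of K "K closure_of V" U] by blast
qed

lemma clopen_separated: "clopen_separated K"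
  unfolding clopen_separated_def
proof (intro ballI impI)
  fix x y assume xy: "x \<in> topspace K" "y \<in> topspace K" "x \<noteq> y"
  then obtain U V where UV: "openin K U" "openin K V" "x \<in> U" "y \<in> V" "U \<inter> V = {}"
    using Hausdorff unfolding Hausdorff_space_def disjnt_def by meson
  have "y \<notin> K closure_of U"
    using openin_Int_closure_of_eq_empty[OF UV(2), of U] UV by blast
  moreover have "x \<in> K closure_of U"
    using UV closure_of_subset[OF openin_subset[OF UV(1)]] by blast
  ultimately show "\<exists>A\<in>clopens K. x \<in> A \<and> y \<notin> A" using closure_clopen[OF UV(1)] by blast
qed

lemma separate:
  "x \<in> topspace K \<Longrightarrow> y \<in> topspace K \<Longrightarrow> x \<noteq> y \<Longrightarrow> \<exists>A\<in>clopens K. x \<in> A \<and> y \<notin> A"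
  using clopen_separated[unfolded clopen_separated_def] by simp

text \<open>Split an infinite clopen set by a clopen set that separates two of its points, keep an infinite
  half, and collect the other halves.\<close>

lemma disjoint_clopens:
  assumes "infinite (topspace K)"
  obtains V :: "nat \<Rightarrow> 'a set" where "range V \<subseteq> clopens K" "disjoint_family V" "\<And>i. V i \<noteq> {}"
proof -
  have step: "\<exists>W'. (W' \<in> clopens K \<and> infinite W') \<and> (W' \<subseteq> W \<and> W - W' \<noteq> {})"
    if W: "W \<in> clopens K \<and> infinite W" for W
  proof -
    have "W \<noteq> {}" using W by auto
    then obtain x where x: "x \<in> W" by blast
    have "infinite (W - {x})" using W by simp
    hence "W - {x} \<noteq> {}" by (metis finite.emptyI)
    then obtain y where y: "y \<in> W" "y \<noteq> x" by blast
    have sub: "W \<subseteq> topspace K" using W clopens_subset by blast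
    then obtain A where A: "A \<in> clopens K" "x \<in> A" "y \<notin> A"
      using separate[of x y] x y by blast
    have "infinite (W \<inter> A) \<or> infinite (W - A)" using W by (metis Int_Diff_Un finite_Un)
    thus ?thesis
    proof
      assume "infinite (W \<inter> A)"
      thus ?thesis using W A y by (intro exI[of _ "W \<inter> A"]) (auto intro: clopens_Int)
    next
      assume "infinite (W - A)"
      thus ?thesis using W A x by (intro exI[of _ "W - A"]) (auto intro: clopens_Diff)
    qed
  qed
  obtain W where W: "\<And>j::nat. W j \<in> clopens K \<and> infinite (W j)"
    "\<And>j. W (Suc j) \<subseteq> W j \<and> W j - W (Suc j) \<noteq> {}"
    using dependent_nat_choice[of "\<lambda>_ W. W \<in> clopens K \<and> infinite W"
        "\<lambda>_ W W'. W' \<subseteq> W \<and> W - W' \<noteq> {}"] step assms clopens_topspace by metis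
  show thesis
  proof (rule that[of "\<lambda>j. W j - W (Suc j)"])
    show "range (\<lambda>j. W j - W (Suc j)) \<subseteq> clopens K" using W by (auto intro: clopens_Diff)
    have sub: "W j \<subseteq> topspace K" for j using W clopens_subset by blast
    have "disjoint_family (\<lambda>j. (topspace K - W (Suc j)) - (topspace K - W j))"
      using W by (intro disjoint_family_Suc) auto
    moreover have "(topspace K - W (Suc j)) - (topspace K - W j) = W j - W (Suc j)" for j
      using sub by blast
    ultimately show "disjoint_family (\<lambda>j. W j - W (Suc j))" by simp
    show "W i - W (Suc i) \<noteq> {}" for i using W by blast
  qed
qed

text \<open>The supremum of \<open>{B j | j. j \<in> M}\<close> in the Boolean algebra of clopen sets, which is complete
  because the space is extremally disconnected.\<close>

definition join :: "(nat \<Rightarrow> 'a set) \<Rightarrow> nat set \<Rightarrow> 'a set" where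
  "join B M = K closure_of (\<Union>j\<in>M. B j)"

context
  fixes B :: "nat \<Rightarrow> 'a set"
  assumes B: "range B \<subseteq> clopens K" "disjoint_family B"
begin

lemma openin_UN_clopens: "openin K (\<Union>j\<in>M. B j)"
  using B(1) by (auto simp: clopens_def)

lemma join_clopen: "join B M \<in> clopens K"
  unfolding join_def by (rule closure_clopen[OF openin_UN_clopens])

lemma UN_subset_join: "(\<Union>j\<in>M. B j) \<subseteq> join B M"
  unfolding join_def by (intro closure_of_subset openin_subset openin_UN_clopens)

lemma join_disjoint:
  assumes "M \<inter> N = {}"
  shows "join B M \<inter> join B N = {}"
proof -
  have "B i \<inter> B j = {}" if "i \<in> M" "j \<in> N" for i j
    using disjoint_family_onD[OF B(2), of i j] that assms by blast
  thus ?thesis unfolding join_def by (intro closures_disjoint openin_UN_clopens) blast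
qed

lemma join_Un: "join B (M \<union> N) = join B M \<union> join B N"
  unfolding join_def by (simp add: UN_Un)

lemma join_mono: "M \<subseteq> N \<Longrightarrow> join B M \<subseteq> join B N"
  using join_Un[of M N] by (auto simp: Un_absorb1)

lemma join_finite:
  assumes "finite M"
  shows "join B M = (\<Union>j\<in>M. B j)"
proof -
  have "closedin K (\<Union>j\<in>M. B j)" using assms B(1) by (intro closedin_Union) (auto simp: clopens_def)
  thus ?thesis unfolding join_def by (rule closure_of_closedin)
qed

lemma Int_join_empty: "j \<notin> M \<Longrightarrow> B j \<inter> join B M = {}"
  using join_disjoint[of "{j}" M] join_finite[of "{j}"] by simp

text \<open>The points that a join adds to the union survive the removal of finitely many of the sets. So for
  almost disjoint index sets they form disjoint sets, and each point is added by at most one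
  member of an almost disjoint family.\<close>

lemma join_almost_disjoint:
  assumes "finite (M \<inter> N)" "x \<in> join B M" "x \<in> join B N"
  shows "x \<in> (\<Union>j\<in>M. B j)"
proof -
  have "join B M = join B (M \<inter> N) \<union> join B (M - N)"
    unfolding join_Un[symmetric] by (simp add: Int_Diff_Un)
  moreover have "join B (M - N) \<inter> join B N = {}" by (rule join_disjoint) blast
  ultimately have "x \<in> (\<Union>j\<in>M \<inter> N. B j)" using assms join_finite[OF assms(1)] by blast
  thus ?thesis by blast
qed

end

end

section \<open>Diffuse contents on disjoint clopen sets\<close>

text \<open>The contents are defined on all sets, so that additivity needs no side conditions; a content on
  the indices of a sequence of points is of this kind.\<close>

locale diffuse_contents = extremally_disconnected_compact +
  fixes m :: "nat \<Rightarrow> 'a set \<Rightarrow> real" and U :: "nat \<Rightarrow> 'a set"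
  assumes m_nonneg: "0 \<le> m k A"
    and m_additive: "A \<inter> B = {} \<Longrightarrow> m k (A \<union> B) = m k A + m k B"
    and m_total: "m k (topspace K) = 1"
    and m_diffuse: "x \<in> topspace K \<Longrightarrow> 0 < e \<Longrightarrow> \<exists>G\<in>clopens K. x \<in> G \<and> m k G < e"
    and U: "range U \<subseteq> clopens K" "disjoint_family U" "m k (U k) = 1"

text \<open>Choose points \<open>v k i\<close> in disjoint clopen sets and transport a diffuse content on the natural
  numbers along \<open>i \<mapsto> v k i\<close>. A join contains exactly those of the chosen points whose index belongs
  to it, so the joins of the residue classes modulo \<open>2 ^ q\<close>, together with the complement of their union,
  partition the space into clopen sets of content at most \<open>1 / 2 ^ q\<close>.\<close>

lemma (in extremally_disconnected_compact) diffuse_contents_exist: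
  assumes "infinite (topspace K)"
  obtains m U where "diffuse_contents K m U"
proof -
  obtain V where V: "range V \<subseteq> clopens K" "disjoint_family V" "\<And>i::nat. V i \<noteq> {}"
    using disjoint_clopens[OF assms] by blast
  obtain d :: "nat set \<Rightarrow> real" where d: "\<And>E. 0 \<le> d E" "d UNIV = 1"
    "\<And>E F. E \<inter> F = {} \<Longrightarrow> d (E \<union> F) = d E + d F"
    "\<And>q c. c < 2 ^ q \<Longrightarrow> d {i. i mod 2 ^ q = c} = 1 / 2 ^ q"
    using diffuse_content_on_nat by blast
  define x where "x j = (SOME x. x \<in> V j)" for j
  have x: "x j \<in> V j" for j unfolding x_def using V(3)[of j] by (simp add: some_in_eq)
  define v where "v k i = x (prod_encode (k, i))" for k i
  define m where "m k A = d {i. v k i \<in> A}" for k A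
  define U where "U k = join V (range (\<lambda>i. prod_encode (k, i)))" for k
  have in_join: "x j \<in> join V M \<longleftrightarrow> j \<in> M" for j M
    using x[of j] Int_join_empty[OF V(1,2), of j M] UN_subset_join[OF V(1,2), of M] by blast
  have d0: "d {} = 0" using d(3)[of "{}" "{}"] by simp
  have "diffuse_contents K m U"
  proof unfold_locales
    show "0 \<le> m k A" for k A unfolding m_def by (rule d(1))
    show "m k (A \<union> B) = m k A + m k B" if "A \<inter> B = {}" for k A B
    proof -
      have "{i. v k i \<in> A \<union> B} = {i. v k i \<in> A} \<union> {i. v k i \<in> B}" by blast
      moreover have "{i. v k i \<in> A} \<inter> {i. v k i \<in> B} = {}" using that by blast
      ultimately show ?thesis unfolding m_def using d(3) by simp
    qed
    have "x j \<in> topspace K" for j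
      using x[of j] V(1) clopens_subset[of "V j" K] by auto
    thus total: "m k (topspace K) = 1" for k unfolding m_def v_def using d(2) by simp
    show "range U \<subseteq> clopens K" unfolding U_def using join_clopen[OF V(1,2)] by blast
    show "disjoint_family U"
      unfolding U_def disjoint_family_on_def
      by (intro ballI impI join_disjoint[OF V(1,2)]) auto
    show "m k (U k) = 1" for k unfolding m_def U_def v_def in_join using d(2) by simp
    fix y k and e :: real assume y: "y \<in> topspace K" and e: "0 < e"
    obtain q where q: "(1/2::real) ^ q < e" using real_arch_pow_inv[of e "1/2"] e by auto
    define H where "H c = join V ((\<lambda>i. prod_encode (k, i)) ` {i. i mod 2 ^ q = c})" for c
    have H: "H c \<in> clopens K" for c unfolding H_def by (rule join_clopen[OF V(1,2)])
    have vH: "v k i \<in> H c \<longleftrightarrow> i mod 2 ^ q = c" for i c unfolding H_def v_def in_join by auto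
    show "\<exists>G\<in>clopens K. y \<in> G \<and> m k G < e"
    proof (cases "\<exists>c<2^q. y \<in> H c")
      case True
      then obtain c where c: "c < 2 ^ q" "y \<in> H c" by blast
      have "m k (H c) = 1 / 2 ^ q" unfolding m_def vH by (rule d(4)[OF c(1)])
      thus ?thesis using c H q by (intro bexI[of _ "H c"]) (auto simp: power_one_over)
    next
      case False
      let ?G = "topspace K - \<Union>(H ` {..<2 ^ q})"
      have "v k i \<notin> ?G" for i using vH[of i "i mod 2 ^ q"] by auto
      hence "{i. v k i \<in> ?G} = {}" by blast
      hence "m k ?G = 0" unfolding m_def using d0 by (simp only:)
      moreover have "?G \<in> clopens K"
        using H by (intro clopens_Diff clopens_topspace clopens_finite_Union) auto
      ultimately show ?thesis using False y e by (intro bexI[of _ ?G]) auto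
    qed
  qed
  thus thesis using that by blast
qed

section \<open>Quotient topologies\<close>

definition quotient_topology :: "'a topology \<Rightarrow> ('a \<Rightarrow> 'b) \<Rightarrow> 'b topology" where
  "quotient_topology X f =
     topology (\<lambda>W. W \<subseteq> f ` topspace X \<and> openin X {x \<in> topspace X. f x \<in> W})"

lemma openin_quotient_topology:
  "openin (quotient_topology X f) W \<longleftrightarrow>
     W \<subseteq> f ` topspace X \<and> openin X {x \<in> topspace X. f x \<in> W}"
proof -
  let ?P = "\<lambda>W. W \<subseteq> f ` topspace X \<and> openin X {x \<in> topspace X. f x \<in> W}"
  have "istopology ?P"
    unfolding istopology_def
  proof (intro conjI allI impI)
    fix S T assume S: "?P S" and T: "?P T"
    have "{x \<in> topspace X. f x \<in> S \<inter> T} = {x \<in> topspace X. f x \<in> S} \<inter> {x \<in> topspace X. f x \<in> T}"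
      by blast
    thus "openin X {x \<in> topspace X. f x \<in> S \<inter> T}" using S T by (simp add: openin_Int)
    show "S \<inter> T \<subseteq> f ` topspace X" using S by blast
  next
    fix \<K> assume \<K>: "\<forall>S\<in>\<K>. ?P S"
    have "{x \<in> topspace X. f x \<in> \<Union>\<K>} = (\<Union>S\<in>\<K>. {x \<in> topspace X. f x \<in> S})" by blast
    moreover have "openin X (\<Union>S\<in>\<K>. {x \<in> topspace X. f x \<in> S})" using \<K> by (intro openin_Union) auto
    ultimately show "openin X {x \<in> topspace X. f x \<in> \<Union>\<K>}" by simp
    show "\<Union>\<K> \<subseteq> f ` topspace X" using \<K> by blast
  qed
  thus ?thesis unfolding quotient_topology_def by simp
qed

lemma topspace_quotient_topology [simp]: "topspace (quotient_topology X f) = f ` topspace X"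
proof
  show "topspace (quotient_topology X f) \<subseteq> f ` topspace X"
    using openin_topspace[of "quotient_topology X f"] unfolding openin_quotient_topology by blast
  have "{x \<in> topspace X. f x \<in> f ` topspace X} = topspace X" by blast
  hence "openin (quotient_topology X f) (f ` topspace X)" by (simp add: openin_quotient_topology)
  thus "f ` topspace X \<subseteq> topspace (quotient_topology X f)" by (rule openin_subset)
qed

lemma continuous_map_quotient_topology: "continuous_map X (quotient_topology X f) f"
  unfolding continuous_map_def by (auto simp: openin_quotient_topology)

lemma compact_space_quotient_topology:
  "compact_space X \<Longrightarrow> compact_space (quotient_topology X f)"
  using image_compactin[OF _ continuous_map_quotient_topology, of X "topspace X" f]
  by (simp add: compact_space_def)

lemma clopens_quotient_topology:
  "A \<in> clopens (quotient_topology X f) \<longleftrightarrow>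
     A \<subseteq> f ` topspace X \<and> {x \<in> topspace X. f x \<in> A} \<in> clopens X"
proof -
  have "{x \<in> topspace X. f x \<in> f ` topspace X - A} = topspace X - {x \<in> topspace X. f x \<in> A}" by blast
  thus ?thesis
    by (auto simp: clopens_def closedin_def openin_quotient_topology)
qed

section \<open>The quotient that collapses the kernel of the null ideal\<close>

context diffuse_contents
begin

lemma m_mono: "A \<subseteq> B \<Longrightarrow> m k A \<le> m k B"
  using m_additive[of A "B - A" k] m_nonneg[of k "B - A"] by (simp add: Un_absorb1)

lemma m_subadditive: "m k (A \<union> B) \<le> m k A + m k B"
  using m_additive[of A "B - A" k] m_mono[of "B - A" B k] by auto

lemma m_empty: "m k {} = 0"
  using m_additive[of "{}" "{}" k] by simp

lemma m_UN_disjoint: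
  assumes "finite I" "disjoint_family_on A I"
  shows "m k (\<Union>i\<in>I. A i) = (\<Sum>i\<in>I. m k (A i))"
  using assms
proof (induction I rule: finite_induct)
  case (insert i I)
  have "A i \<inter> \<Union>(A ` I) = {}"
    using insert by (auto simp: disjoint_family_on_def)
  moreover have "disjoint_family_on A I" using insert.prems by (rule disjoint_family_on_mono[rotated]) blast
  ultimately show ?case using insert m_additive by simp
qed (simp add: m_empty)

lemma m_le_1: "A \<in> clopens K \<Longrightarrow> m k A \<le> 1"
  using m_mono[OF clopens_subset, of A K k] m_total by simp

lemma m_tendsto_zero:
  assumes "\<And>k. m k A \<le> f k" "f \<longlonglongrightarrow> 0"
  shows "(\<lambda>k. m k A) \<longlonglongrightarrow> 0"
  by (rule Lim_null_comparison[OF _ assms(2)]) (simp add: assms(1) m_nonneg)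

text \<open>The clopen sets on which the contents vanish in the limit form an ideal. \<open>kernel\<close> is the closed set
  of points outside all of them; it becomes the single point \<open>point\<close> of the quotient \<open>L\<close>, and the clopen
  sets of \<open>L\<close> are the members of the ideal and their complements.\<close>

definition null :: "'a set set" where
  "null = {A \<in> clopens K. (\<lambda>k. m k A) \<longlonglongrightarrow> 0}"

definition kernel :: "'a set" where
  "kernel = topspace K - \<Union>null"

definition point :: 'a where
  "point = (SOME p. p \<in> kernel)"

definition collapse :: "'a \<Rightarrow> 'a" where
  "collapse x = (if x \<in> kernel then point else x)"

definition L :: "'a topology" where
  "L = quotient_topology K collapse"

lemma null_clopen: "A \<in> null \<Longrightarrow> A \<in> clopens K"
  unfolding null_def by blast

lemma null_finite_Union:
  assumes "finite F" "F \<subseteq> null"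
  shows "\<Union>F \<in> null"
  using assms
proof (induction F rule: finite_induct)
  case empty
  show ?case by (simp add: null_def clopens_empty m_empty)
next
  case (insert A F)
  have "(\<lambda>k. m k A + m k (\<Union>F)) \<longlonglongrightarrow> 0 + 0"
    using insert by (intro tendsto_add) (auto simp: null_def)
  hence "(\<lambda>k. m k (A \<union> \<Union>F)) \<longlonglongrightarrow> 0"
    by (intro m_tendsto_zero[OF m_subadditive]) simp
  thus ?case using insert by (auto simp: null_def intro: clopens_Un)
qed

lemma null_subset: "A \<in> null \<Longrightarrow> B \<in> clopens K \<Longrightarrow> B \<subseteq> A \<Longrightarrow> B \<in> null"
  using m_tendsto_zero[of B "\<lambda>k. m k A"] m_mono[of B A] unfolding null_def by blast

lemma null_iff: "A \<in> clopens K \<Longrightarrow> A \<in> null \<longleftrightarrow> A \<inter> kernel = {}"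
proof
  assume A: "A \<in> clopens K" "A \<inter> kernel = {}"
  have "compactin K A" using A(1) by (intro closedin_compact_space[OF compact]) (simp add: clopens_def)
  moreover have "A \<subseteq> \<Union>null"
    using A clopens_subset[OF A(1)] unfolding kernel_def by blast
  moreover have "\<And>G. G \<in> null \<Longrightarrow> openin K G" using null_clopen unfolding clopens_def by blast
  ultimately obtain F where F: "finite F" "F \<subseteq> null" "A \<subseteq> \<Union>F"
    using compactinD[of K A null] by metis
  show "A \<in> null" using null_subset[OF null_finite_Union[OF F(1,2)] A(1) F(3)] .
next
  assume "A \<in> null"
  thus "A \<inter> kernel = {}" unfolding kernel_def by blast
qed

text \<open>The kernel is not empty: otherwise the whole space would be in the ideal, by compactness, though
  it has content 1 for all \<open>k\<close>.\<close>

lemma point_in_kernel: "point \<in> kernel"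
proof -
  have "kernel \<noteq> {}"
  proof
    assume "kernel = {}"
    hence "topspace K \<in> null" using null_iff[OF clopens_topspace] by blast
    hence "(\<lambda>k. 1::real) \<longlonglongrightarrow> 0" by (simp add: null_def m_total)
    thus False by (simp add: LIMSEQ_const_iff)
  qed
  thus ?thesis unfolding point_def by (simp add: some_in_eq)
qed

lemma topspace_L: "topspace L = (topspace K - kernel) \<union> {point}"
  using point_in_kernel unfolding L_def collapse_def by (auto simp: kernel_def)

lemma clopens_L_avoiding: "point \<notin> A \<Longrightarrow> A \<in> clopens L \<longleftrightarrow> A \<in> null"
proof -
  assume p: "point \<notin> A"
  have pre: "{x \<in> topspace K. collapse x \<in> A} = A" if "A \<subseteq> topspace K" "A \<inter> kernel = {}"
    using that p unfolding collapse_def by auto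
  show ?thesis
  proof
    assume A: "A \<in> clopens L"
    hence "A \<subseteq> topspace L" by (rule clopens_subset)
    hence AK: "A \<subseteq> topspace K" "A \<inter> kernel = {}" using p unfolding topspace_L by auto
    hence "A \<in> clopens K" using A pre unfolding L_def clopens_quotient_topology by simp
    thus "A \<in> null" using null_iff AK by blast
  next
    assume A: "A \<in> null"
    hence AK: "A \<subseteq> topspace K" "A \<inter> kernel = {}"
      using A clopens_subset[OF null_clopen[OF A]] null_iff[OF null_clopen[OF A]] by auto
    moreover have "A \<subseteq> collapse ` topspace K"
      using AK topspace_L unfolding L_def by auto
    ultimately show "A \<in> clopens L"
      using null_clopen[OF A] pre unfolding L_def clopens_quotient_topology by simp
  qed
qed

lemma null_clopens_L: "A \<in> null \<Longrightarrow> A \<in> clopens L"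
  using clopens_L_avoiding[of A] null_iff[of A] null_clopen[of A] point_in_kernel by blast

lemma clopen_separated_L: "clopen_separated L"
  unfolding clopen_separated_def
proof (intro ballI impI)
  have sep: "\<exists>A\<in>clopens L. x \<in> A \<and> y \<notin> A" if x: "x \<in> topspace L" "x \<noteq> point"
    and y: "y \<in> topspace L" "x \<noteq> y" for x y
  proof -
    have xK: "x \<in> topspace K" "x \<notin> kernel" using x unfolding topspace_L by auto
    then obtain A where A: "A \<in> null" "x \<in> A" unfolding kernel_def by blast
    show ?thesis
    proof (cases "y \<in> kernel")
      case True
      hence "y \<notin> A" using A null_iff null_clopen by blast
      thus ?thesis using A null_clopens_L by blast
    next
      case False
      hence "y \<in> topspace K" using y point_in_kernel unfolding topspace_L by auto
      then obtain G where G: "G \<in> clopens K" "x \<in> G" "y \<notin> G"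
        using separate[of x y] xK y by blast
      have "A \<inter> G \<in> null" using null_subset[OF A(1)] A G null_clopen clopens_Int by blast
      thus ?thesis using A G null_clopens_L by (intro bexI[of _ "A \<inter> G"]) auto
    qed
  qed
  fix x y assume xy: "x \<in> topspace L" "y \<in> topspace L" "x \<noteq> y"
  show "\<exists>A\<in>clopens L. x \<in> A \<and> y \<notin> A"
  proof (cases "x = point")
    case True
    then obtain A where "A \<in> clopens L" "y \<in> A" "x \<notin> A" using sep[of y x] xy by auto
    thus ?thesis using xy by (intro bexI[of _ "topspace L - A"]) (auto intro: clopens_Diff clopens_topspace)
  qed (use sep xy in blast)
qed

text \<open>The content \<open>m k\<close> is concentrated on \<open>U k\<close>, which is disjoint from \<open>U j\<close> for \<open>k \<noteq> j\<close>.\<close>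

lemma U_null: "U j \<in> null"
proof -
  have "m k (U j) = 0" if "k \<noteq> j" for k
  proof -
    have "U k \<inter> U j = {}" using disjoint_family_onD[OF U(2), of k j] that by simp
    hence "1 + m k (U j) = m k (U k \<union> U j)" using m_additive U(3) by simp
    also have "\<dots> \<le> 1" using U(1) by (intro m_le_1 clopens_Un) auto
    finally show ?thesis using m_nonneg[of k "U j"] by linarith
  qed
  hence "\<forall>\<^sub>F k in sequentially. m k (U j) = 0"
    unfolding eventually_sequentially by (intro exI[of _ "Suc j"]) auto
  hence "(\<lambda>k. m k (U j)) \<longlonglongrightarrow> 0" by (rule tendsto_eventually)
  thus ?thesis using U(1) unfolding null_def by blast
qed

lemma not_grothendieck_L: "\<not> grothendieck_property L"
proof (rule contents_to_point_not_grothendieck)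
  show L: "compact_space L" unfolding L_def by (rule compact_space_quotient_topology[OF compact])
  show "clopen_separated L" by (rule clopen_separated_L)
  show "point \<in> topspace L" unfolding topspace_L by simp
  show "clopen_content L (m k)" for k
    by unfold_locales (use L clopen_separated_L m_nonneg m_additive in auto)
  have UK: "U k \<inter> kernel = {}" "U k \<subseteq> topspace K" for k
    using U_null[of k] null_iff[OF null_clopen[OF U_null]] clopens_subset[OF null_clopen[OF U_null]]
    by auto
  show "m k (topspace L) = 1" for k
  proof (rule antisym)
    have "topspace L \<subseteq> topspace K" using point_in_kernel unfolding topspace_L kernel_def by auto
    thus "m k (topspace L) \<le> 1" using m_mono m_total by metis
    have "U k \<subseteq> topspace L" using UK[of k] unfolding topspace_L by blast
    thus "1 \<le> m k (topspace L)" using m_mono U(3) by metis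
  qed
  show "(\<lambda>k. m k A) \<longlonglongrightarrow> 0" if "A \<in> clopens L" "point \<notin> A" for A
    using that clopens_L_avoiding unfolding null_def by blast
  show "U k \<in> clopens L" for k using null_clopens_L U_null .
  show "disjoint_family U" by (rule U(2))
  show "point \<notin> U k" for k using UK[of k] point_in_kernel by blast
  show "m k (U k) = 1" for k by (rule U(3))
qed

section \<open>Interpolation in the quotient\<close>

text \<open>Since \<open>A\<close> is null, only finitely many \<open>k\<close> have \<open>m k A \<ge> e\<close>; for each of these, diffuseness provides a
  clopen neighbourhood of small content.\<close>

lemma small_null_neighbourhood:
  assumes x: "x \<in> A" "A \<in> null" and e: "0 < e"
  shows "\<exists>G\<in>null. x \<in> G \<and> G \<subseteq> A \<and> (\<forall>k. m k G < e)"
proof -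
  have xK: "x \<in> topspace K" using x clopens_subset[OF null_clopen[OF x(2)]] by blast
  obtain k0 where k0: "\<And>k. k \<ge> k0 \<Longrightarrow> m k A < e"
    using x(2) e order_tendstoD(2)[of "\<lambda>k. m k A" 0 sequentially e]
    unfolding null_def eventually_sequentially by auto
  have "\<exists>G\<in>clopens K. x \<in> G \<and> G \<subseteq> A \<and> (\<forall>k<n. m k G < e)" for n
  proof (induction n)
    case 0
    show ?case using x null_clopen by auto
  next
    case (Suc n)
    then obtain G where G: "G \<in> clopens K" "x \<in> G" "G \<subseteq> A" "\<And>k. k < n \<Longrightarrow> m k G < e" by blast
    obtain H where H: "H \<in> clopens K" "x \<in> H" "m n H < e" using m_diffuse[OF xK e] by blast
    have "m k (G \<inter> H) < e" if "k < Suc n" for k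
    proof (cases "k = n")
      case True
      thus ?thesis using H(3) m_mono[of "G \<inter> H" H n] by auto
    next
      case False
      thus ?thesis using G(4)[of k] that m_mono[of "G \<inter> H" G k] by auto
    qed
    thus ?case using G H by (intro bexI[of _ "G \<inter> H"]) (auto intro: clopens_Int)
  qed
  then obtain G where G: "G \<in> clopens K" "x \<in> G" "G \<subseteq> A" "\<And>k. k < k0 \<Longrightarrow> m k G < e" by blast
  have "m k G < e" for k
    using G(4)[of k] k0[of k] m_mono[OF G(3), of k] by (cases "k < k0") auto
  thus ?thesis using G null_subset[OF x(2) G(1,3)] by blast
qed

lemma small_null_superset:
  assumes "finite T" "T \<subseteq> A" "A \<in> null" "0 < e"
  shows "\<exists>G\<in>null. T \<subseteq> G \<and> G \<subseteq> A \<and> (\<forall>k. m k G < e)"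
  using assms(1,2,4)
proof (induction T arbitrary: e rule: finite_induct)
  case empty
  have "{} \<in> null" using null_finite_Union[of "{}"] by simp
  thus ?case using empty by (intro bexI[of _ "{}"]) (auto simp: m_empty)
next
  case (insert x T)
  obtain G where G: "G \<in> null" "T \<subseteq> G" "G \<subseteq> A" "\<And>k. m k G < e/2"
    using insert.IH[of "e/2"] insert.prems by auto
  obtain H where H: "H \<in> null" "x \<in> H" "H \<subseteq> A" "\<And>k. m k H < e/2"
    using small_null_neighbourhood[of x A "e/2"] insert.prems assms(3) by auto
  have "m k (G \<union> H) < e" for k using G(4)[of k] H(4)[of k] m_subadditive[of k G H] by linarith
  moreover have "G \<union> H \<in> null" using null_finite_Union[of "{G, H}"] G H by simp
  ultimately show ?case using G H by (intro bexI[of _ "G \<union> H"]) auto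
qed

text \<open>Beyond a suitable \<open>J\<close>, finitely many of the index sets are disjoint and so are their joins, but
  a content of total mass 1 leaves room only for finitely many disjoint sets of content \<open>e\<close>.\<close>

lemma join_tail_small:
  assumes B: "range B \<subseteq> clopens K" "disjoint_family B"
    and M: "\<And>r s :: real. r \<noteq> s \<Longrightarrow> finite (M r \<inter> M s)"
    and e: "0 < e"
  shows "finite {r. \<forall>J. e \<le> m k (join B (M r - {..<J}))}" (is "finite ?R")
proof (rule ccontr)
  assume "infinite ?R"
  obtain n :: nat where n: "1 / e < n" using reals_Archimedean2 by blast
  obtain F where F: "F \<subseteq> ?R" "finite F" "card F = n"
    using infinite_arbitrarily_large[OF \<open>infinite ?R\<close>, of n] by (elim exE conjE) (rule that)
  have "finite (\<Union>r\<in>F. \<Union>s\<in>F - {r}. M r \<inter> M s)"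
    using F(2) by (intro finite_UN_I finite_Diff M) auto
  then obtain J where J: "(\<Union>r\<in>F. \<Union>s\<in>F - {r}. M r \<inter> M s) \<subseteq> {..<J}"
    using finite_nat_iff_bounded by blast
  define C where "C r = join B (M r - {..<J})" for r
  have "disjoint_family_on C F"
    unfolding disjoint_family_on_def C_def using J by (intro ballI impI join_disjoint[OF B]) blast
  hence "(\<Sum>r\<in>F. m k (C r)) = m k (\<Union>r\<in>F. C r)" using m_UN_disjoint[OF F(2)] by simp
  also have "\<dots> \<le> 1"
    using F(2) unfolding C_def by (intro m_le_1 clopens_finite_Union) (auto intro: join_clopen[OF B])
  finally have "(\<Sum>r\<in>F. m k (C r)) \<le> 1" .
  moreover have "(\<Sum>r\<in>F. e) \<le> (\<Sum>r\<in>F. m k (C r))" using F(1) unfolding C_def by (intro sum_mono) auto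
  moreover have "(\<Sum>r\<in>F. e) = n * e" using F(3) by simp
  moreover have "1 < n * e" using n e by (simp add: field_simps)
  ultimately show False by linarith
qed

text \<open>A join may have a larger limit content than the union it closes, and it may contain further points
  of \<open>S\<close>. Both defects are excluded for all but countably many members of an uncountable almost disjoint
  family: the first since there are only countably many contents \<open>m k\<close>, the second since \<open>S\<close> is
  countable. For any other member the content of the join is the sum of the contents of the sets
  \<open>B j\<close>; each summand tends to 0 in \<open>k\<close>, and the sums are dominated by a geometric series.\<close>

lemma null_join_of_subfamily:
  assumes B: "range B \<subseteq> null" "disjoint_family B" "\<And>j k. m k (B j) < (1/2) ^ j"
    and N: "infinite N" and S: "countable S"
  shows "\<exists>M. infinite M \<and> M \<subseteq> N \<and> join B M \<in> null \<and> join B M \<inter> S = (\<Union>j\<in>M. B j) \<inter> S"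
proof -
  have BK: "range B \<subseteq> clopens K" using B(1) null_clopen by blast
  obtain M :: "real \<Rightarrow> nat set" where M: "\<And>r. infinite (M r)" "\<And>r. M r \<subseteq> N"
    "\<And>r s. r \<noteq> s \<Longrightarrow> finite (M r \<inter> M s)" using almost_disjoint_family[OF N] by blast
  define R where "R = (\<Union>k. \<Union>q. {r. \<forall>J. inverse (real (Suc q)) \<le> m k (join B (M r - {..<J}))})"
  define Q where "Q = (\<Union>x\<in>S. {r. x \<in> join B (M r) - (\<Union>j\<in>M r. B j)})"
  have "countable {r. \<forall>J. inverse (real (Suc q)) \<le> m k (join B (M r - {..<J}))}" for k q
    by (rule countable_finite, rule join_tail_small[OF BK B(2) M(3)]) simp_all
  hence "countable R" unfolding R_def by (intro countable_UN) auto
  moreover have "countable Q"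
  proof -
    have "finite {r. x \<in> join B (M r) - (\<Union>j\<in>M r. B j)}" for x
    proof -
      have "r = s" if "x \<in> join B (M r) - (\<Union>j\<in>M r. B j)" "x \<in> join B (M s)" for r s
        using join_almost_disjoint[OF BK B(2) M(3), of r s x] that by blast
      hence "{r. x \<in> join B (M r) - (\<Union>j\<in>M r. B j)} \<subseteq> {s}" if "x \<in> join B (M s)" for s
        using that by blast
      thus ?thesis
        by (metis (mono_tags, lifting) DiffD1 Collect_empty_eq finite.simps finite_subset)
    qed
    thus ?thesis unfolding Q_def by (intro countable_UN[OF S] countable_finite)
  qed
  ultimately have "R \<union> Q \<noteq> UNIV" using uncountable_UNIV_real by (metis countable_Un)
  then obtain r where r: "r \<notin> R" "r \<notin> Q" by blast
  let ?C = "join B (M r)"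
  have CK: "?C \<in> clopens K" by (rule join_clopen[OF BK B(2)])
  have tail: "\<exists>J. m k (join B (M r - {..<J})) < d" if "0 < d" for k d
  proof -
    obtain q where "inverse (real (Suc q)) < d" using reals_Archimedean[OF \<open>0 < d\<close>] by blast
    thus ?thesis using r(1) unfolding R_def by (auto simp: not_le) (meson less_trans)
  qed
  have bound: "m k ?C \<le> (\<Sum>j<J. m k (B j)) + 2 * (1/2) ^ J" for k J
  proof (rule field_le_epsilon)
    fix d :: real assume "0 < d"
    then obtain J' where J': "m k (join B (M r - {..<J'})) < d" using tail by blast
    let ?J = "max J J'"
    have "?C = join B (M r \<inter> {..<?J}) \<union> join B (M r - {..<?J})"
      unfolding join_Un[OF BK B(2), symmetric] by (simp add: Int_Diff_Un)
    hence "m k ?C \<le> m k (join B (M r \<inter> {..<?J})) + m k (join B (M r - {..<?J}))"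
      using m_subadditive by metis
    also have "m k (join B (M r - {..<?J})) \<le> m k (join B (M r - {..<J'}))"
      by (intro m_mono join_mono[OF BK B(2)]) auto
    also have "m k (join B (M r \<inter> {..<?J})) \<le> (\<Sum>j<?J. m k (B j))"
    proof -
      have "m k (join B (M r \<inter> {..<?J})) \<le> m k (\<Union>j<?J. B j)"
        by (intro m_mono) (auto simp: join_finite[OF BK B(2)])
      also have "\<dots> = (\<Sum>j<?J. m k (B j))"
        using B(2) by (intro m_UN_disjoint) (auto simp: disjoint_family_on_def)
      finally show ?thesis .
    qed
    also have "(\<Sum>j<?J. m k (B j)) = (\<Sum>j<J. m k (B j)) + (\<Sum>j=J..<?J. m k (B j))"
      by (simp add: lessThan_atLeast0 sum.atLeastLessThan_concat)
    also have "(\<Sum>j=J..<?J. m k (B j)) \<le> (\<Sum>j=J..<?J. (1/2) ^ j)"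
      using B(3) by (intro sum_mono less_imp_le)
    also have "(\<Sum>j=J..<?J. (1/2::real) ^ j) = (1/2) ^ J * (\<Sum>i<?J - J. (1/2) ^ i)"
    proof -
      have "(\<Sum>j=J..<?J. (1/2::real) ^ j) = (\<Sum>i=0..<?J - J. (1/2) ^ (i + J))"
        using sum.shift_bounds_nat_ivl[of "\<lambda>j. (1/2::real) ^ j" 0 J "?J - J"] by simp
      thus ?thesis by (simp add: power_add sum_distrib_left mult.commute lessThan_atLeast0)
    qed
    also have "\<dots> \<le> (1/2) ^ J * 2"
      using geometric_sum_less[of "1/2::real" "{..<?J - J}"] by (intro mult_left_mono) auto
    finally show "m k ?C \<le> (\<Sum>j<J. m k (B j)) + 2 * (1/2) ^ J + d" using J' by linarith
  qed
  have "(\<lambda>k. m k ?C) \<longlonglongrightarrow> 0"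
  proof (rule LIMSEQ_I)
    fix e :: real assume e: "0 < e"
    obtain J where J: "(1/2::real) ^ J < e/4" using real_arch_pow_inv[of "e/4" "1/2"] e by auto
    have "(\<lambda>k. \<Sum>j<J. m k (B j)) \<longlonglongrightarrow> (\<Sum>j<J. 0)"
      using B(1) by (intro tendsto_sum) (auto simp: null_def)
    hence "\<forall>\<^sub>F k in sequentially. (\<Sum>j<J. m k (B j)) < e/2"
      using e by (intro order_tendstoD(2)) auto
    then obtain k0 where k0: "\<And>k. k \<ge> k0 \<Longrightarrow> (\<Sum>j<J. m k (B j)) < e/2"
      unfolding eventually_sequentially by blast
    have "norm (m k ?C - 0) < e" if "k \<ge> k0" for k
      using bound[of k J] k0[OF that] J m_nonneg[of k ?C] by simp
    thus "\<exists>k0. \<forall>k\<ge>k0. norm (m k ?C - 0) < e" by blast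
  qed
  hence "?C \<in> null" using CK unfolding null_def by blast
  moreover have "?C \<inter> S = (\<Union>j\<in>M r. B j) \<inter> S"
    using r(2) UN_subset_join[OF BK B(2), of "M r"] unfolding Q_def by blast
  ultimately show ?thesis using M(1,2)[of r] by blast
qed

text \<open>Where \<open>A j\<close> misses the collapsed point, the finite set \<open>T j\<close> has clopen neighbourhoods of content
  below \<open>(1/2) ^ j\<close>, and joins of these can be kept null. At most one \<open>A j\<close> contains the collapsed point;
  it is not shrunk, and its index is left out of \<open>I\<close>.\<close>

lemma interpolating_L: "interpolating (clopens L)"
  unfolding interpolating_def
proof (intro allI impI)
  fix A :: "nat \<Rightarrow> 'a set" and T
  assume A: "range A \<subseteq> clopens L" "disjoint_family A" and T: "\<forall>j. finite (T j) \<and> T j \<subseteq> A j"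
  have "\<exists>G. G \<in> clopens L \<and> T j \<subseteq> G \<and> G \<subseteq> A j \<and>
          (point \<notin> A j \<longrightarrow> G \<in> null \<and> (\<forall>k. m k G < (1/2) ^ j))" for j
  proof (cases "point \<in> A j")
    case True
    thus ?thesis using A(1) T by (intro exI[of _ "A j"]) auto
  next
    case False
    hence "A j \<in> null" using A(1) clopens_L_avoiding by blast
    then obtain G where "G \<in> null" "T j \<subseteq> G" "G \<subseteq> A j" "\<forall>k. m k G < (1/2) ^ j"
      using small_null_superset[of "T j" "A j" "(1/2) ^ j"] T by auto
    thus ?thesis using null_clopens_L by blast
  qed
  then obtain B where B: "\<And>j. B j \<in> clopens L" "\<And>j. T j \<subseteq> B j" "\<And>j. B j \<subseteq> A j"
    "\<And>j. point \<notin> A j \<Longrightarrow> B j \<in> null" "\<And>j k. point \<notin> A j \<Longrightarrow> m k (B j) < (1/2) ^ j" by metis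
  define B' where "B' j = (if point \<in> A j then {} else B j)" for j
  have "{} \<in> null" using null_finite_Union[of "{}"] by simp
  hence B': "range B' \<subseteq> null" "\<And>j k. m k (B' j) < (1/2) ^ j"
    using B(4,5) by (auto simp: B'_def m_empty)
  have "disjoint_family B'"
    using A(2) by (rule disjoint_family_subset) (use B(3) in \<open>auto simp: B'_def\<close>)
  note good = null_join_of_subfamily[OF B'(1) this B'(2)]
  have pick: "\<exists>I C. infinite I \<and> I \<subseteq> N \<and> C \<in> clopens L \<and> C \<inter> S = (\<Union>j\<in>I. B j) \<inter> S"
    if N: "infinite N" and S: "countable S" for N S
  proof -
    have "finite {j. point \<in> A j}"
    proof (cases "\<exists>i. point \<in> A i")
      case True
      then obtain i where "point \<in> A i" by blast
      hence "{j. point \<in> A j} \<subseteq> {i}" using disjoint_family_onD[OF A(2)] by blast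
      thus ?thesis using finite_subset by blast
    qed simp
    hence "infinite (N - {j. point \<in> A j})" using N by simp
    from good[OF this S] obtain I where I: "infinite I" "I \<subseteq> N - {j. point \<in> A j}"
      "join B' I \<in> null" "join B' I \<inter> S = (\<Union>j\<in>I. B' j) \<inter> S"
      by (elim exE conjE) (rule that)
    have "(\<Union>j\<in>I. B' j) = (\<Union>j\<in>I. B j)" using I(2) by (auto simp: B'_def)
    thus ?thesis using I null_clopens_L by (intro exI[of _ I] exI[of _ "join B' I"]) auto
  qed
  show "\<exists>B. range B \<subseteq> clopens L \<and> (\<forall>j. T j \<subseteq> B j \<and> B j \<subseteq> A j) \<and>
          (\<forall>N S. infinite N \<longrightarrow> countable S \<longrightarrow>
             (\<exists>I C. infinite I \<and> I \<subseteq> N \<and> C \<in> clopens L \<and> C \<inter> S = (\<Union>j\<in>I. B j) \<inter> S))"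
    by (intro exI[of _ B] conjI allI impI pick) (use B in auto)
qed

end

section \<open>A quotient that separates the two properties\<close>

theorem theorem7p3:
  fixes K :: "'a topology"
  assumes "compact_space K" and "Hausdorff_space K"
    and "extremally_disconnected_space K"
    and "infinite (topspace K)"
  shows "\<exists>(L :: 'a topology) \<phi>.
           compact_space L \<and> Hausdorff_space L \<and>
           continuous_map K L \<phi> \<and> \<phi> ` topspace K = topspace L \<and>
           \<not> grothendieck_property L \<and> ell1_grothendieck_property L"
proof -
  interpret extremally_disconnected_compact K using assms(1-3) by unfold_locales
  obtain m U where "diffuse_contents K m U" using diffuse_contents_exist[OF assms(4)] .
  then interpret diffuse_contents K m U .
  show ?thesis
  proof (intro exI conjI)
    show "compact_space L" unfolding L_def by (rule compact_space_quotient_topology[OF assms(1)])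
    show "Hausdorff_space L" by (rule clopen_separated_Hausdorff[OF clopen_separated_L])
    show "continuous_map K L collapse" unfolding L_def by (rule continuous_map_quotient_topology)
    show "collapse ` topspace K = topspace L" unfolding L_def by simp
    show "\<not> grothendieck_property L" by (rule not_grothendieck_L)
    show "ell1_grothendieck_property L"
      by (rule interpolating_clopens_ell1_grothendieck[OF clopen_separated_L interpolating_L])
  qed
qed

end
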